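(* Let $\mathbb{M}$ be a monster model of some theory and $K$ a definable field in $\mathbb{M}$. Suppose that to every definable set $X\subseteq K^n$ (for all $n$) is assigned a dimension $\dim(X)\in\mathbb{N}\cup\{-\infty\}$ such that: (1) $\dim(X)=-\infty$ iff $X=\emptyset$; (2) $\dim(K)>0$; (3) if $\dim(X)>0$ then $X$ is infinite; (4) $\dim(X\times Y)=\dim(X)+\dim(Y)$; (5) $\dim(X\cup Y)=\max(\dim X,\dim Y)$; (6) if $f:X\to Y$ is a definable surjection with finite fibers (in particular a definable bijection) then $\dim(X)=\dim(Y)$. Suppose moreover that $\tau$ is a definable field topology on $K$ such that (7) for every definable $X\subseteq K^n$, $\dim(X)=\dim(K^n)$ iff $X$ has non-empty interior in the product topology on $K^n$. Then $(K,\tau)$ is bronze t-henselian.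
   Context: "Definable" means definable with parameters in $\mathbb{M}$; a topology on $K$ is definable if it has a basis given by a definable family of sets; a field topology is one in which the field operations are continuous. Let $K[X]^d_1$ be the set of monic polynomials of degree $d$ over $K$, topologized by identification with $K^d$ via coefficients. $\tau$ is bronze t-henselian if whenever $Q\in K[X]^d_1$ is separable and has a root in $K$, there is a neighborhood $V$ of $Q$ in $K[X]^d_1$ such that every $P\in V$ has a root in $K$. *)

theory Defs
  imports "HOL-Analysis.Analysis" "HOL-Computational_Algebra.Polynomial"
begin

unbundle cardinal_syntax

section \<open>First-order logic\<close>

datatype 'f trm = Var nat | Fn 'f "'f trm list"

datatype ('f, 'r) fm =
    Eq "'f trm" "'f trm"
  | Rel 'r "'f trm list"
  | Neg "('f, 'r) fm"
  | And "('f, 'r) fm" "('f, 'r) fm"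
  | Ex nat "('f, 'r) fm"

text \<open>A one-sorted language together with a structure for it. The universe of the structure is
  the whole type \<open>'m\<close>. The symbol sets \<open>funs\<close> and \<open>rels\<close> may be empty; constants are function
  symbols of arity 0. Interpretations matter only on symbols of the language and on argument lists
  of the right length.\<close>

record ('f, 'r, 'm) fo_struct =
  funs :: "'f set"
  rels :: "'r set"
  fun_ar :: "'f \<Rightarrow> nat"
  rel_ar :: "'r \<Rightarrow> nat"
  fun_int :: "'f \<Rightarrow> 'm list \<Rightarrow> 'm"
  rel_int :: "'r \<Rightarrow> 'm list \<Rightarrow> bool"

fun wf_trm :: "('f, 'r, 'm) fo_struct \<Rightarrow> 'f trm \<Rightarrow> bool" where
  "wf_trm M (Var i) = True"
| "wf_trm M (Fn f ts) = (f \<in> funs M \<and> length ts = fun_ar M f \<and> (\<forall>t\<in>set ts. wf_trm M t))"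

fun wf_fm :: "('f, 'r, 'm) fo_struct \<Rightarrow> ('f, 'r) fm \<Rightarrow> bool" where
  "wf_fm M (Eq s t) = (wf_trm M s \<and> wf_trm M t)"
| "wf_fm M (Rel r ts) = (r \<in> rels M \<and> length ts = rel_ar M r \<and> (\<forall>t\<in>set ts. wf_trm M t))"
| "wf_fm M (Neg \<phi>) = wf_fm M \<phi>"
| "wf_fm M (And \<phi> \<psi>) = (wf_fm M \<phi> \<and> wf_fm M \<psi>)"
| "wf_fm M (Ex i \<phi>) = wf_fm M \<phi>"

fun fv_trm :: "'f trm \<Rightarrow> nat set" where
  "fv_trm (Var i) = {i}"
| "fv_trm (Fn f ts) = (\<Union>t\<in>set ts. fv_trm t)"

fun fv_fm :: "('f, 'r) fm \<Rightarrow> nat set" where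
  "fv_fm (Eq s t) = fv_trm s \<union> fv_trm t"
| "fv_fm (Rel r ts) = (\<Union>t\<in>set ts. fv_trm t)"
| "fv_fm (Neg \<phi>) = fv_fm \<phi>"
| "fv_fm (And \<phi> \<psi>) = fv_fm \<phi> \<union> fv_fm \<psi>"
| "fv_fm (Ex i \<phi>) = fv_fm \<phi> - {i}"

fun val :: "('f, 'r, 'm) fo_struct \<Rightarrow> (nat \<Rightarrow> 'm) \<Rightarrow> 'f trm \<Rightarrow> 'm" where
  "val M e (Var i) = e i"
| "val M e (Fn f ts) = fun_int M f (map (val M e) ts)"

fun sat :: "('f, 'r, 'm) fo_struct \<Rightarrow> (nat \<Rightarrow> 'm) \<Rightarrow> ('f, 'r) fm \<Rightarrow> bool" where
  "sat M e (Eq s t) = (val M e s = val M e t)"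
| "sat M e (Rel r ts) = rel_int M r (map (val M e) ts)"
| "sat M e (Neg \<phi>) = (\<not> sat M e \<phi>)"
| "sat M e (And \<phi> \<psi>) = (sat M e \<phi> \<and> sat M e \<psi>)"
| "sat M e (Ex i \<phi>) = (\<exists>a. sat M (e(i := a)) \<phi>)"


section \<open>Monster models\<close>

text \<open>A formula with parameters is a pair \<open>(\<phi>, e)\<close>: the free variables of \<open>\<phi>\<close> other than the
  designated ones are read as names for their values under \<open>e\<close>.\<close>

definition partial_type1 ::
  "('f, 'r, 'm) fo_struct \<Rightarrow> 'm set \<Rightarrow> (('f, 'r) fm \<times> (nat \<Rightarrow> 'm)) set \<Rightarrow> bool" where
  "partial_type1 M A p \<longleftrightarrow>
     (\<forall>(\<phi>, e)\<in>p. wf_fm M \<phi> \<and> e ` (fv_fm \<phi> - {0}) \<subseteq> A) \<and>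
     (\<forall>q\<subseteq>p. finite q \<longrightarrow> (\<exists>a. \<forall>(\<phi>, e)\<in>q. sat M (e(0 := a)) \<phi>))"

definition saturated :: "'c rel \<Rightarrow> ('f, 'r, 'm) fo_struct \<Rightarrow> bool" where
  "saturated \<kappa> M \<longleftrightarrow>
     (\<forall>A p. |A| <o \<kappa> \<longrightarrow> partial_type1 M A p \<longrightarrow> (\<exists>a. \<forall>(\<phi>, e)\<in>p. sat M (e(0 := a)) \<phi>))"

definition partial_elementary :: "('f, 'r, 'm) fo_struct \<Rightarrow> 'm set \<Rightarrow> ('m \<Rightarrow> 'm) \<Rightarrow> bool" where
  "partial_elementary M A f \<longleftrightarrow>
     (\<forall>\<phi> e. wf_fm M \<phi> \<longrightarrow> e ` fv_fm \<phi> \<subseteq> A \<longrightarrow> sat M e \<phi> = sat M (f \<circ> e) \<phi>)"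

definition automorphism :: "('f, 'r, 'm) fo_struct \<Rightarrow> ('m \<Rightarrow> 'm) \<Rightarrow> bool" where
  "automorphism M \<sigma> \<longleftrightarrow> bij \<sigma> \<and>
     (\<forall>f\<in>funs M. \<forall>xs. length xs = fun_ar M f \<longrightarrow> \<sigma> (fun_int M f xs) = fun_int M f (map \<sigma> xs)) \<and>
     (\<forall>r\<in>rels M. \<forall>xs. length xs = rel_ar M r \<longrightarrow> rel_int M r xs = rel_int M r (map \<sigma> xs))"

definition strongly_homogeneous :: "'c rel \<Rightarrow> ('f, 'r, 'm) fo_struct \<Rightarrow> bool" where
  "strongly_homogeneous \<kappa> M \<longleftrightarrow>
     (\<forall>A f. |A| <o \<kappa> \<longrightarrow> partial_elementary M A f \<longrightarrow>
        (\<exists>\<sigma>. automorphism M \<sigma> \<and> (\<forall>a\<in>A. \<sigma> a = f a)))"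

text \<open>A monster model (of its own complete theory): \<open>\<kappa>\<close>-saturated and strongly \<open>\<kappa>\<close>-homogeneous
  for a cardinal \<open>\<kappa>\<close> larger than the number of formulas of the language, which is
  \<open>|L| + \<aleph>\<^sub>0\<close>; in particular \<open>\<kappa>\<close> is uncountable.\<close>

definition monster_model :: "'c rel \<Rightarrow> ('f, 'r, 'm) fo_struct \<Rightarrow> bool" where
  "monster_model \<kappa> M \<longleftrightarrow>
     Card_order \<kappa> \<and> |{\<phi>. wf_fm M \<phi>}| <o \<kappa> \<and> saturated \<kappa> M \<and> strongly_homogeneous \<kappa> M"


section \<open>Definable sets and definable fields\<close>

text \<open>Tuples are lists. Variables \<open>0, \<dots>, n - 1\<close> stand for the coordinates and all
  other free variables (finitely many) for parameters, whose values are given by \<open>e\<close>.\<close>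

definition definable :: "('f, 'r, 'm) fo_struct \<Rightarrow> nat \<Rightarrow> 'm list set \<Rightarrow> bool" where
  "definable M n D \<longleftrightarrow>
     (\<exists>\<phi> e. wf_fm M \<phi> \<and>
        D = {xs. length xs = n \<and> sat M (\<lambda>i. if i < n then xs ! i else e i) \<phi>})"

text \<open>A definable field is a field structure on a definable subset of some \<open>M\<^sup>k\<close> whose operations
  have definable graphs. The elements of the field form the type \<open>'k\<close>, and \<open>\<iota>\<close> is the
  identification of \<open>'k\<close> with the definable set. (Negation, inverse and the constants are
  then definable as well.)\<close>

definition definable_field ::
  "('f, 'r, 'm) fo_struct \<Rightarrow> nat \<Rightarrow> ('k::field \<Rightarrow> 'm list) \<Rightarrow> bool" where
  "definable_field M k \<iota> \<longleftrightarrow>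
     inj \<iota> \<and> (\<forall>x. length (\<iota> x) = k) \<and> definable M k (range \<iota>) \<and>
     definable M (3 * k) {\<iota> x @ \<iota> y @ \<iota> (x + y) | x y. True} \<and>
     definable M (3 * k) {\<iota> x @ \<iota> y @ \<iota> (x * y) | x y. True}"

text \<open>\<open>K\<^sup>n\<close> is the set of lists of length \<open>n\<close> over \<open>'k\<close>; such a list is regarded as a tuple from
  \<open>M\<^bsup>n * k\<^esup>\<close> by concatenating the images of its entries.\<close>

definition K_power :: "nat \<Rightarrow> 'k list set" where
  "K_power n = {xs. length xs = n}"

definition K_definable ::
  "('f, 'r, 'm) fo_struct \<Rightarrow> nat \<Rightarrow> ('k \<Rightarrow> 'm list) \<Rightarrow> nat \<Rightarrow> 'k list set \<Rightarrow> bool" where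
  "K_definable M k \<iota> n X \<longleftrightarrow>
     X \<subseteq> K_power n \<and> definable M (n * k) ((\<lambda>xs. concat (map \<iota> xs)) ` X)"

definition list_times :: "'k list set \<Rightarrow> 'k list set \<Rightarrow> 'k list set" where
  "list_times X Y = {xs @ ys | xs ys. xs \<in> X \<and> ys \<in> Y}"

definition definable_surj_finite_fibers ::
  "('f, 'r, 'm) fo_struct \<Rightarrow> nat \<Rightarrow> ('k \<Rightarrow> 'm list) \<Rightarrow> nat \<Rightarrow> nat \<Rightarrow>
     'k list set \<Rightarrow> 'k list set \<Rightarrow> ('k list \<Rightarrow> 'k list) \<Rightarrow> bool" where
  "definable_surj_finite_fibers M k \<iota> m n X Y f \<longleftrightarrow>
     K_definable M k \<iota> m X \<and> K_definable M k \<iota> n Y \<and>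
     K_definable M k \<iota> (m + n) {xs @ f xs | xs. xs \<in> X} \<and>
     f ` X = Y \<and> (\<forall>y\<in>Y. finite {x\<in>X. f x = y})"


section \<open>Definable field topologies\<close>

definition field_topology :: "'k::field topology \<Rightarrow> bool" where
  "field_topology \<tau> \<longleftrightarrow> topspace \<tau> = UNIV \<and>
     continuous_map (prod_topology \<tau> \<tau>) \<tau> (\<lambda>(x, y). x + y) \<and>
     continuous_map \<tau> \<tau> uminus \<and>
     continuous_map (prod_topology \<tau> \<tau>) \<tau> (\<lambda>(x, y). x * y) \<and>
     continuous_map (subtopology \<tau> (- {0})) \<tau> inverse"

text \<open>A definable family of subsets of \<open>K\<close> consists of the fibers \<open>B\<^sub>y\<close>, for \<open>y \<in> Y\<close>, of a
  definable set \<open>B \<subseteq> M\<^sup>k \<times> M\<^sup>m\<close>, where the index set \<open>Y \<subseteq> M\<^sup>m\<close> is definable.\<close>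

definition definable_topology ::
  "('f, 'r, 'm) fo_struct \<Rightarrow> nat \<Rightarrow> ('k \<Rightarrow> 'm list) \<Rightarrow> 'k topology \<Rightarrow> bool" where
  "definable_topology M k \<iota> \<tau> \<longleftrightarrow>
     (\<exists>m Y B. definable M m Y \<and> definable M (k + m) B \<and>
        openin \<tau> = arbitrary union_of (\<lambda>U. \<exists>ys\<in>Y. U = {x. \<iota> x @ ys \<in> B}))"

definition power_topology :: "'k topology \<Rightarrow> nat \<Rightarrow> 'k list topology" where
  "power_topology \<tau> n =
     pullback_topology (K_power n) (\<lambda>xs. \<lambda>i\<in>{..<n}. xs ! i) (product_topology (\<lambda>_. \<tau>) {..<n})"


section \<open>Bronze t-henselianity\<close>

definition monic_polys :: "nat \<Rightarrow> 'k::field poly set" where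
  "monic_polys d = {P. degree P = d \<and> lead_coeff P = 1}"

definition monic_topology :: "'k::field topology \<Rightarrow> nat \<Rightarrow> 'k poly topology" where
  "monic_topology \<tau> d =
     pullback_topology (monic_polys d) (\<lambda>P. map (coeff P) [0..<d]) (power_topology \<tau> d)"

definition separable_poly :: "'k::field poly \<Rightarrow> bool" where
  "separable_poly P \<longleftrightarrow> coprime P (pderiv P)"

definition bronze_t_henselian :: "'k::field topology \<Rightarrow> bool" where
  "bronze_t_henselian \<tau> \<longleftrightarrow>
     (\<forall>d. \<forall>Q\<in>monic_polys d. separable_poly Q \<and> (\<exists>x. poly Q x = 0) \<longrightarrow>
        (\<exists>V. openin (monic_topology \<tau> d) V \<and> Q \<in> V \<and> (\<forall>P\<in>V. \<exists>x. poly P x = 0)))"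

end

theory Submission
  imports Defs "Jordan_Normal_Form.Char_Poly" "HOL-Algebra.Algebraic_Closure_Type"
begin

text \<open>Let \<open>Q\<close> be monic and separable of degree \<open>d\<close> with a root \<open>a\<close> in \<open>K\<close>. For a polynomial \<open>g\<close> of degree
  below \<open>d\<close> let \<open>T\<^sub>g(P)\<close> be the characteristic polynomial of multiplication by \<open>g\<close> on
  \<open>K[X]/(P)\<close>. The map sending \<open>g\<close> to \<open>T\<^sub>g(Q)\<close> is polynomial with finite fibres, and its values
  have the root \<open>g(a)\<close>. The \<open>g\<close> that generate \<open>K[X]/(Q)\<close> form a nonempty Zariski open set \<open>W\<close>, which
  has full dimension; so the image of \<open>W\<close> has full dimension, hence interior points, one of which is
  \<open>T\<^sub>g(Q)\<close> for some \<open>g\<close> in \<open>W\<close>. If \<open>P\<close> is close to \<open>Q\<close>, then \<open>T\<^sub>g(P)\<close> is still in the image of \<open>W\<close>,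
  so it has a root in \<open>K\<close>, and \<open>g\<close> still generates \<open>K[X]/(P)\<close>. The eigenspaces of \<open>g\<close> are then lines
  stable under multiplication by \<open>X\<close>, so an eigenvector of \<open>g\<close> over \<open>K\<close> yields a root of \<open>P\<close> in \<open>K\<close>.\<close>

unbundle no vec_syntax

no_notation var (\<open>X\<index>\<close>) \<comment> \<open>it makes \<open>X\<close> a keyword\<close>

section \<open>Substitution in formulas\<close>

fun ren_trm :: "(nat \<Rightarrow> nat) \<Rightarrow> 'f trm \<Rightarrow> 'f trm" where
  "ren_trm r (Var i) = Var (r i)"
| "ren_trm r (Fn f ts) = Fn f (map (ren_trm r) ts)"

lemma val_ren_trm: "val M e (ren_trm r t) = val M (e \<circ> r) t"
proof (induction t)
  case (Fn f ts)
  then show ?case by (simp add: comp_def cong: map_cong)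
qed simp

lemma wf_ren_trm: "wf_trm M t \<Longrightarrow> wf_trm M (ren_trm r t)"
  by (induction t) auto

lemma finite_fv_trm: "finite (fv_trm t)"
  by (induction t) auto

lemma finite_fv_fm: "finite (fv_fm \<phi>)"
  by (induction \<phi>) (auto simp: finite_fv_trm)

lemma val_cong: "(\<And>i. i \<in> fv_trm t \<Longrightarrow> e i = e' i) \<Longrightarrow> val M e t = val M e' t"
proof (induction t)
  case (Fn f ts)
  then have "map (val M e) ts = map (val M e') ts" by auto
  then show ?case by (simp only: val.simps)
qed simp

lemma sat_cong: "(\<And>i. i \<in> fv_fm \<phi> \<Longrightarrow> e i = e' i) \<Longrightarrow> sat M e \<phi> = sat M e' \<phi>"
proof (induction \<phi> arbitrary: e e')
  case (Eq s t)
  then show ?case using val_cong[of s e e' M] val_cong[of t e e' M] by simp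
next
  case (Rel r ts)
  then have "map (val M e) ts = map (val M e') ts"
    by (auto intro!: val_cong)
  then show ?case by (simp only: sat.simps)
next
  case (Neg \<phi>)
  then show ?case by (metis fv_fm.simps(3) sat.simps(3))
next
  case (And \<phi> \<psi>)
  have "sat M e \<phi> = sat M e' \<phi>" "sat M e \<psi> = sat M e' \<psi>"
    using And.prems by (auto intro!: And.IH)
  then show ?case by simp
next
  case (Ex i \<phi>)
  have "sat M (e(i := a)) \<phi> = sat M (e'(i := a)) \<phi>" for a
    using Ex.prems by (intro Ex.IH) auto
  then show ?case by simp
qed

text \<open>Bound variables are renamed to fresh ones, so \<open>r\<close> need not be injective.\<close>

lemma ex_ren_fm:
  "wf_fm M \<phi> \<Longrightarrow> \<exists>\<phi>'. wf_fm M \<phi>' \<and> (\<forall>e. sat M e \<phi>' \<longleftrightarrow> sat M (e \<circ> r) \<phi>)"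
proof (induction \<phi> arbitrary: r)
  case (Eq s t)
  then show ?case
    by (intro exI[of _ "Eq (ren_trm r s) (ren_trm r t)"]) (auto simp: val_ren_trm wf_ren_trm comp_def)
next
  case (Rel s ts)
  have "map (val M e) (map (ren_trm r) ts) = map (val M (e \<circ> r)) ts" for e
    unfolding map_map by (intro map_cong) (simp_all add: val_ren_trm)
  then have "sat M e (Rel s (map (ren_trm r) ts)) \<longleftrightarrow> sat M (e \<circ> r) (Rel s ts)" for e
    by (simp only: sat.simps)
  moreover have "wf_fm M (Rel s (map (ren_trm r) ts))" using Rel by (auto simp: wf_ren_trm)
  ultimately show ?case by blast
next
  case (Neg \<phi>)
  obtain \<phi>' where "wf_fm M \<phi>'" "\<forall>e. sat M e \<phi>' \<longleftrightarrow> sat M (e \<circ> r) \<phi>"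
    using Neg.IH[OF Neg.prems[unfolded wf_fm.simps], of r] by blast
  then show ?case by (intro exI[of _ "Neg \<phi>'"]) (simp add: comp_def)
next
  case (And \<phi> \<psi>)
  from And.prems have "wf_fm M \<phi>" "wf_fm M \<psi>" by simp_all
  from And.IH(1)[OF this(1), of r] And.IH(2)[OF this(2), of r]
  obtain \<phi>' \<psi>' where "wf_fm M \<phi>'" "\<forall>e. sat M e \<phi>' \<longleftrightarrow> sat M (e \<circ> r) \<phi>"
    "wf_fm M \<psi>'" "\<forall>e. sat M e \<psi>' \<longleftrightarrow> sat M (e \<circ> r) \<psi>" by blast
  then show ?case by (intro exI[of _ "And \<phi>' \<psi>'"]) (simp add: comp_def)
next
  case (Ex i \<phi>)
  obtain z where z: "z \<notin> r ` fv_fm \<phi>"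
    using finite_fv_fm ex_new_if_finite[OF infinite_UNIV_nat] by (metis finite_imageI)
  from Ex.prems have "wf_fm M \<phi>" by simp
  from Ex.IH[OF this, of "r(i := z)"] obtain \<phi>' where \<phi>': "wf_fm M \<phi>'"
    "\<And>e. sat M e \<phi>' \<longleftrightarrow> sat M (e \<circ> r(i := z)) \<phi>" by blast
have "sat M (e(z := a)) \<phi>' \<longleftrightarrow> sat M ((e \<circ> r)(i := a)) \<phi>" for e a
    unfolding \<phi>'(2) using z by (intro sat_cong) auto
  then have "sat M e (Ex z \<phi>') \<longleftrightarrow> sat M (e \<circ> r) (Ex i \<phi>)" for e
    by (simp only: sat.simps)
  moreover have "wf_fm M (Ex z \<phi>')" using \<phi>'(1) by simp
  ultimately show ?case by blast
qed


section \<open>Definable predicates of valuations\<close>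

text \<open>Predicates of infinite valuations make substitution and quantification free of arity
  bookkeeping; each variable of the formula is either an argument or a parameter.\<close>

definition definable_pred :: "('f, 'r, 'm) fo_struct \<Rightarrow> ((nat \<Rightarrow> 'm) \<Rightarrow> bool) \<Rightarrow> bool" where
  "definable_pred M P \<longleftrightarrow>
     (\<exists>\<phi> f. wf_fm M \<phi> \<and> (\<forall>v. P v \<longleftrightarrow> sat M (case_sum v id \<circ> f) \<phi>))"

lemma definable_pred_not: "definable_pred M P \<Longrightarrow> definable_pred M (\<lambda>v. \<not> P v)"
proof -
  assume "definable_pred M P"
  then obtain \<phi> f where
    "wf_fm M \<phi>" "\<And>v. P v \<longleftrightarrow> sat M (case_sum v id \<circ> f) \<phi>"
    unfolding definable_pred_def by blast
  then show ?thesis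
    unfolding definable_pred_def by (intro exI[of _ "Neg \<phi>"] exI[of _ f]) simp
qed

lemma definable_pred_conj:
  assumes "definable_pred M P" "definable_pred M Q"
  shows "definable_pred M (\<lambda>v. P v \<and> Q v)"
proof -
  from assms obtain \<phi> f \<psi> g where
    \<phi>: "wf_fm M \<phi>" "\<And>v. P v \<longleftrightarrow> sat M (case_sum v id \<circ> f) \<phi>" and
    \<psi>: "wf_fm M \<psi>" "\<And>v. Q v \<longleftrightarrow> sat M (case_sum v id \<circ> g) \<psi>"
    unfolding definable_pred_def by blast
  \<comment> \<open>The two formulas get the even and the odd variables, so that the unrelated
    assignments \<open>f\<close> and \<open>g\<close> merge into one assignment
    \<open>h\<close>.\<close>
  obtain \<phi>' where \<phi>': "wf_fm M \<phi>'" "\<And>e. sat M e \<phi>' \<longleftrightarrow> sat M (e \<circ> (\<lambda>i. 2 * i)) \<phi>"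
    using ex_ren_fm[OF \<phi>(1)] by meson
  obtain \<psi>' where \<psi>': "wf_fm M \<psi>'" "\<And>e. sat M e \<psi>' \<longleftrightarrow> sat M (e \<circ> (\<lambda>i. 2 * i + 1)) \<psi>"
    using ex_ren_fm[OF \<psi>(1)] by meson
  define h where "h i = (if even i then f (i div 2) else g (i div 2))" for i
  have "(case_sum v id \<circ> h) \<circ> (\<lambda>i. 2 * i) = case_sum v id \<circ> f"
       "(case_sum v id \<circ> h) \<circ> (\<lambda>i. 2 * i + 1) = case_sum v id \<circ> g" for v
    by (auto simp: h_def)
  then show ?thesis
    unfolding definable_pred_def using \<phi>' \<psi>' \<phi>(2) \<psi>(2)
    by (intro exI[of _ "And \<phi>' \<psi>'"] exI[of _ h]) simp
qed

text \<open>Renaming arguments or replacing them by parameters changes only the assignment of the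
  variables; the formula stays the same.\<close>

lemma definable_pred_subst:
  assumes "definable_pred M P"
  shows "definable_pred M (\<lambda>v. P (case_sum v id \<circ> h))"
proof -
  from assms obtain \<phi> f where
    \<phi>: "wf_fm M \<phi>" "\<And>v. P v \<longleftrightarrow> sat M (case_sum v id \<circ> f) \<phi>"
    unfolding definable_pred_def by blast
  have "case_sum (case_sum v id \<circ> h) id \<circ> f = case_sum v id \<circ> (case_sum h Inr \<circ> f)" for v
    by (auto split: sum.split)
  with \<phi> show ?thesis
    unfolding definable_pred_def
    by (intro exI[of _ \<phi>] exI[of _ "case_sum h Inr \<circ> f"]) simp
qed

lemma definable_pred_ren: "definable_pred M P \<Longrightarrow> definable_pred M (\<lambda>v. P (\<lambda>i. v (r i)))"
  using definable_pred_subst[of M P "\<lambda>i. Inl (r i)"] by (simp add: comp_def)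

lemma definable_pred_ex:
  assumes "definable_pred M P"
  shows "definable_pred M (\<lambda>v. \<exists>a. P (case_nat a v))"
proof -
  from assms obtain \<phi> f where
    \<phi>: "wf_fm M \<phi>" "\<And>v. P v \<longleftrightarrow> sat M (case_sum v id \<circ> f) \<phi>"
    unfolding definable_pred_def by blast
  \<comment> \<open>Every variable that stands for argument 0 is merged into variable 0, which is
    then bound; the others move up by one. \<open>h\<close> undoes both shifts, that of the
    variables and that of the arguments of \<open>case_nat a v\<close>.\<close>
  obtain \<phi>' where \<phi>': "wf_fm M \<phi>'"
    "\<And>e. sat M e \<phi>' \<longleftrightarrow> sat M (e \<circ> (\<lambda>i. if f i = Inl 0 then 0 else Suc i)) \<phi>"
    using ex_ren_fm[OF \<phi>(1)] by meson
  define h where "h i = (case f (i - 1) of Inl j \<Rightarrow> Inl (j - 1) | Inr m \<Rightarrow> Inr m)" for i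
  have "((case_sum v id \<circ> h)(0 := a)) \<circ> (\<lambda>i. if f i = Inl 0 then 0 else Suc i)
      = case_sum (case_nat a v) id \<circ> f" for v a
    by (rule ext) (auto simp: h_def split: sum.split nat.split)
  with \<phi>' \<phi>(2) have "(\<exists>a. P (case_nat a v)) \<longleftrightarrow> sat M (case_sum v id \<circ> h) (Ex 0 \<phi>')" for v
    by simp
  with \<phi>'(1) show ?thesis
    unfolding definable_pred_def by (intro exI[of _ "Ex 0 \<phi>'"] exI[of _ h]) simp
qed

text \<open>The class \<open>S\<close> is arbitrary so that the lemma serves both for the structure
  and for the field. The last entry of the list is quantified outermost, which lets
  \<open>case_nat\<close> put it right after the first \<open>m\<close> entries.\<close>

lemma ex_list_induct:
  assumes P: "S P"
    and ren: "\<And>P r. S P \<Longrightarrow> S (\<lambda>v. P (\<lambda>i. v (r i :: nat)))"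
    and ex: "\<And>P. S P \<Longrightarrow> S (\<lambda>v. \<exists>a. P (case_nat a v))"
  shows "S (\<lambda>v. \<exists>xs. length xs = m \<and> P (\<lambda>i. if i < m then xs ! i else v (i - m)))"
  using P
proof (induction m arbitrary: P)
  case 0
  then show ?case by simp
next
  case (Suc m)
  have "S (\<lambda>v. \<exists>a. \<exists>xs. length xs = m \<and>
          P (\<lambda>i. if i < m then xs ! i else case_nat a v (i - m)))"
    by (intro ex Suc.IH Suc.prems)
  moreover have "(\<lambda>i. if i < m then xs ! i else case_nat a v (i - m)) =
      (\<lambda>i. if i < Suc m then (xs @ [a]) ! i else v (i - Suc m))"
    if "length xs = m" for xs a and v :: "nat \<Rightarrow> 'a"
  proof
    fix i
    consider "i < m" | "i = m" | j where "i = Suc m + j"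
      by (metis Suc_leI le_Suc_ex nat_neq_iff)
    then show "(if i < m then xs ! i else case_nat a v (i - m)) =
        (if i < Suc m then (xs @ [a]) ! i else v (i - Suc m))"
      using that by cases (auto simp: nth_append)
  qed
  moreover have "(\<exists>xs. length xs = Suc m \<and> R xs) \<longleftrightarrow> (\<exists>a xs. length xs = m \<and> R (xs @ [a]))"
    for R :: "'a list \<Rightarrow> bool"
    by (auto simp: length_Suc_conv_rev)
  ultimately show ?case by (simp cong: conj_cong)
qed

lemma definable_pred_ex_list:
  "definable_pred M P \<Longrightarrow>
   definable_pred M (\<lambda>v. \<exists>xs. length xs = m \<and> P (\<lambda>i. if i < m then xs ! i else v (i - m)))"
  by (rule ex_list_induct[of "definable_pred M"])
     (auto intro: definable_pred_ren definable_pred_ex)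

lemma definable_iff_pred:
  "definable M n D \<longleftrightarrow> (\<forall>xs\<in>D. length xs = n) \<and> definable_pred M (\<lambda>v. map v [0..<n] \<in> D)"
proof (intro iffI conjI)
  assume "definable M n D"
  then obtain \<phi> e where \<phi>: "wf_fm M \<phi>"
    "D = {xs. length xs = n \<and> sat M (\<lambda>i. if i < n then xs ! i else e i) \<phi>}"
    unfolding definable_def by blast
  then show "\<forall>xs\<in>D. length xs = n" by simp
  define f :: "nat \<Rightarrow> nat + _" where "f i = (if i < n then Inl i else Inr (e i))" for i
  have "(\<lambda>i. if i < n then map v [0..<n] ! i else e i) = case_sum v id \<circ> f" for v
    by (auto simp: f_def)
  with \<phi> show "definable_pred M (\<lambda>v. map v [0..<n] \<in> D)"
    unfolding definable_pred_def by auto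
next
  assume asm: "(\<forall>xs\<in>D. length xs = n) \<and> definable_pred M (\<lambda>v. map v [0..<n] \<in> D)"
  then obtain \<phi> f where \<phi>: "wf_fm M \<phi>"
    "\<And>v. map v [0..<n] \<in> D \<longleftrightarrow> sat M (case_sum v id \<circ> f) \<phi>"
    unfolding definable_pred_def by blast
  \<comment> \<open>Coordinates keep their number, a variable assigned to an argument beyond the
    first \<open>n\<close> becomes \<open>n\<close>, and parameters go above \<open>n\<close>, with
    their values stored in \<open>e\<close>. Giving all further arguments the one value
    \<open>e n\<close> is harmless because \<open>D\<close> sees only the first
    \<open>n\<close>.\<close>
  define r where "r i = (case f i of Inl j \<Rightarrow> if j < n then j else n | Inr m \<Rightarrow> n + 1 + i)" for i
  define e where "e i = (case f (i - (n + 1)) of Inl j \<Rightarrow> undefined | Inr m \<Rightarrow> m)" for i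
  obtain \<phi>' where \<phi>': "wf_fm M \<phi>'" "\<And>e. sat M e \<phi>' \<longleftrightarrow> sat M (e \<circ> r) \<phi>"
    using ex_ren_fm[OF \<phi>(1)] by meson
  have "xs \<in> D \<longleftrightarrow> sat M (\<lambda>i. if i < n then xs ! i else e i) \<phi>'" if len: "length xs = n" for xs
  proof -
    let ?v = "\<lambda>i. if i < n then xs ! i else e n"
    have "map ?v [0..<n] = xs" using len by (auto intro: nth_equalityI)
    then have "xs \<in> D \<longleftrightarrow> sat M (case_sum ?v id \<circ> f) \<phi>" using \<phi>(2) by metis
    also have "case_sum ?v id \<circ> f = (\<lambda>i. if i < n then xs ! i else e i) \<circ> r"
      by (rule ext) (auto simp: r_def e_def split: sum.split)
    finally show ?thesis unfolding \<phi>'(2) .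
  qed
  with asm have "D = {xs. length xs = n \<and> sat M (\<lambda>i. if i < n then xs ! i else e i) \<phi>'}" by auto
  with \<phi>'(1) show "definable M n D" unfolding definable_def by blast
qed


section \<open>Definable predicates over the field\<close>

text \<open>A valuation in the field is flattened into one in the structure, each element taking
  \<open>k\<close> consecutive positions. \<open>Q\<close> is unconstrained on valuations that are
  not such codes, so quantifiers and definable sets have to be relativized to
  \<open>range \<iota>\<close> separately.\<close>

definition K_pred ::
  "('f, 'r, 'm) fo_struct \<Rightarrow> nat \<Rightarrow> ('k \<Rightarrow> 'm list) \<Rightarrow> ((nat \<Rightarrow> 'k) \<Rightarrow> bool) \<Rightarrow> bool" where
  "K_pred M k \<iota> P \<longleftrightarrow>
     (\<exists>Q. definable_pred M Q \<and> (\<forall>v. P v \<longleftrightarrow> Q (\<lambda>j. \<iota> (v (j div k)) ! (j mod k))))"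

definition K_fun ::
  "('f, 'r, 'm) fo_struct \<Rightarrow> nat \<Rightarrow> ('k \<Rightarrow> 'm list) \<Rightarrow> ((nat \<Rightarrow> 'k) \<Rightarrow> 'k) \<Rightarrow> bool" where
  "K_fun M k \<iota> t \<longleftrightarrow> K_pred M k \<iota> (\<lambda>v. v 0 = t (\<lambda>i. v (Suc i)))"

text \<open>Polynomial functions are generated inductively so that their definability and their
  continuity are each a rule induction.\<close>

inductive polyfun :: "nat \<Rightarrow> ('k::comm_ring_1 list \<Rightarrow> 'k) \<Rightarrow> bool" for n where
  polyfun_const: "polyfun n (\<lambda>_. c)"
| polyfun_nth: "i < n \<Longrightarrow> polyfun n (\<lambda>xs. xs ! i)"
| polyfun_add: "polyfun n f \<Longrightarrow> polyfun n g \<Longrightarrow> polyfun n (\<lambda>xs. f xs + g xs)"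
| polyfun_mult: "polyfun n f \<Longrightarrow> polyfun n g \<Longrightarrow> polyfun n (\<lambda>xs. f xs * g xs)"

lemma definable_pred_all_less:
  fixes n :: nat
  assumes "\<And>i. i < n \<Longrightarrow> definable_pred M (P i)"
  shows "definable_pred M (\<lambda>v. \<forall>i<n. P i v)"
  using assms
proof (induction n)
  case 0
  have "definable_pred M (\<lambda>v. True)"
    unfolding definable_pred_def
    by (intro exI[of _ "Eq (Var 0) (Var 0)"] exI[of _ "\<lambda>_. Inl 0"]) simp
  then show ?case by simp
next
  case (Suc n)
  have "(\<forall>i<Suc n. P i v) \<longleftrightarrow> (\<forall>i<n. P i v) \<and> P n v" for v
    by (auto simp: less_Suc_eq)
  with Suc show ?case by (simp add: definable_pred_conj)
qed

context
  fixes M :: "('f, 'r, 'm) fo_struct" and k :: nat and \<iota> :: "'k::field \<Rightarrow> 'm list"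
  assumes field: "definable_field M k \<iota>"
begin

lemma length_embed: "length (\<iota> x) = k"
  using field unfolding definable_field_def by blast

lemma inj_embed: "inj \<iota>"
  using field unfolding definable_field_def by blast

lemma embed_dim_pos: "k > 0"
proof (rule ccontr)
  assume "\<not> k > 0"
  then have "\<iota> 0 = \<iota> 1" using length_embed by (metis gr0I length_0_conv)
  with inj_embed show False by (metis injD zero_neq_one)
qed

lemma embed_block: "i < k \<Longrightarrow> (c * k + i) div k = c" "i < k \<Longrightarrow> (c * k + i) mod k = i"
  by auto

lemma map_code:
  "map (\<lambda>j. \<iota> (v (j div k)) ! (j mod k)) [0..<n * k] = concat (map \<iota> (map v [0..<n]))"
proof (induction n)
  case (Suc n)
  have "map (\<lambda>j. \<iota> (v (j div k)) ! (j mod k)) [n * k..<n * k + k] = \<iota> (v n)"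
    by (rule nth_equalityI) (auto simp: length_embed embed_block)
  with Suc show ?case by (simp add: upt_add_eq_append[of 0 "n * k" k] add.commute[of k])
qed simp

lemma concat_embed_inject:
  assumes "length xs = length ys" "concat (map \<iota> xs) = concat (map \<iota> ys)"
  shows "xs = ys"
proof -
  have "map \<iota> xs = map \<iota> ys"
    using assms by (intro concat_injective) (auto simp: length_embed set_zip)
  then show ?thesis using inj_embed by (metis inj_map_eq_map)
qed

lemma K_pred_not: "K_pred M k \<iota> P \<Longrightarrow> K_pred M k \<iota> (\<lambda>v. \<not> P v)"
  unfolding K_pred_def using definable_pred_not by fast

lemma K_pred_conj:
  assumes "K_pred M k \<iota> P" "K_pred M k \<iota> Q"
  shows "K_pred M k \<iota> (\<lambda>v. P v \<and> Q v)"
proof -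
  from assms obtain P' Q' where
    "definable_pred M P'" "\<And>v. P v \<longleftrightarrow> P' (\<lambda>j. \<iota> (v (j div k)) ! (j mod k))"
    "definable_pred M Q'" "\<And>v. Q v \<longleftrightarrow> Q' (\<lambda>j. \<iota> (v (j div k)) ! (j mod k))"
    unfolding K_pred_def by blast
  then show ?thesis
    unfolding K_pred_def
    by (intro exI[of _ "\<lambda>w. P' w \<and> Q' w"]) (simp add: definable_pred_conj)
qed

lemma K_pred_subst:
  assumes "K_pred M k \<iota> P"
  shows "K_pred M k \<iota> (\<lambda>v. P (case_sum v id \<circ> h))"
proof -
  from assms obtain Q where
    Q: "definable_pred M Q" "\<And>v. P v \<longleftrightarrow> Q (\<lambda>j. \<iota> (v (j div k)) ! (j mod k))"
    unfolding K_pred_def by blast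
  define h' where "h' j = (case h (j div k) of
      Inl i \<Rightarrow> Inl (i * k + j mod k) | Inr c \<Rightarrow> Inr (\<iota> c ! (j mod k)))" for j
  have "(\<lambda>j. \<iota> ((case_sum v id \<circ> h) (j div k)) ! (j mod k)) =
      case_sum (\<lambda>j. \<iota> (v (j div k)) ! (j mod k)) id \<circ> h'" for v
    using embed_dim_pos by (auto simp: h'_def fun_eq_iff split: sum.split)
  with Q definable_pred_subst[OF Q(1), of h'] show ?thesis
    unfolding K_pred_def
    by (intro exI[of _ "\<lambda>w. Q (case_sum w id \<circ> h')"]) simp
qed

lemma K_pred_ren: "K_pred M k \<iota> P \<Longrightarrow> K_pred M k \<iota> (\<lambda>v. P (\<lambda>i. v (r i)))"
  using K_pred_subst[of P "\<lambda>i. Inl (r i)"] by (simp add: comp_def)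

lemma K_pred_ex:
  assumes "K_pred M k \<iota> P"
  shows "K_pred M k \<iota> (\<lambda>v. \<exists>a. P (case_nat a v))"
proof -
  from assms obtain Q where
    Q: "definable_pred M Q" "\<And>v. P v \<longleftrightarrow> Q (\<lambda>j. \<iota> (v (j div k)) ! (j mod k))"
    unfolding K_pred_def by blast
  \<comment> \<open>An arbitrary block of \<open>k\<close> elements need not code a field element;
    \<open>R\<close> relativizes the quantifier to \<open>range \<iota>\<close>, which is
    definable.\<close>
  define R where "R w \<longleftrightarrow> map w [0..<k] \<in> range \<iota> \<and> Q w" for w
  have "definable M k (range \<iota>)" using field unfolding definable_field_def by blast
  then have "definable_pred M R"
    unfolding R_def definable_iff_pred using Q(1) by (auto intro: definable_pred_conj)
  then have *: "definable_pred M (\<lambda>w. \<exists>xs. length xs = k \<and> R (\<lambda>i. if i < k then xs ! i else w (i - k)))"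
    by (rule definable_pred_ex_list)
  have R_iff: "R (\<lambda>i. if i < k then xs ! i else w (i - k)) \<longleftrightarrow>
      xs \<in> range \<iota> \<and> Q (\<lambda>i. if i < k then xs ! i else w (i - k))" if "length xs = k" for xs w
  proof -
    have "map (\<lambda>i. if i < k then xs ! i else w (i - k)) [0..<k] = xs"
      using that by (intro nth_equalityI) auto
    then show ?thesis unfolding R_def by simp
  qed
  have code: "(\<lambda>j. \<iota> (case_nat a v (j div k)) ! (j mod k)) =
      (\<lambda>i. if i < k then \<iota> a ! i else (\<lambda>j. \<iota> (v (j div k)) ! (j mod k)) (i - k))" for a v
  proof
    fix j
    show "\<iota> (case_nat a v (j div k)) ! (j mod k) =
        (if j < k then \<iota> a ! j else (\<lambda>j. \<iota> (v (j div k)) ! (j mod k)) (j - k))"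
    proof (cases "j < k")
      case False
      then have "j div k = Suc ((j - k) div k)" "j mod k = (j - k) mod k"
        using embed_dim_pos by (simp_all add: le_div_geq le_mod_geq)
      with False show ?thesis by simp
    qed simp
  qed
  have "(\<exists>a. P (case_nat a v)) \<longleftrightarrow> (\<exists>xs. length xs = k \<and>
      R (\<lambda>i. if i < k then xs ! i else (\<lambda>j. \<iota> (v (j div k)) ! (j mod k)) (i - k)))" for v
    unfolding Q(2) code using R_iff[of _ "\<lambda>j. \<iota> (v (j div k)) ! (j mod k)"] length_embed by blast
  with * show ?thesis unfolding K_pred_def by (intro exI conjI) auto
qed

lemma K_pred_ex_list:
  "K_pred M k \<iota> P \<Longrightarrow>
   K_pred M k \<iota> (\<lambda>v. \<exists>xs. length xs = m \<and> P (\<lambda>i. if i < m then xs ! i else v (i - m)))"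
  by (rule ex_list_induct[of "K_pred M k \<iota>"]) (auto intro: K_pred_ren K_pred_ex)

lemma K_pred_graph:
  assumes "definable M (3 * k) {\<iota> x @ \<iota> y @ \<iota> (g x y) | x y. True}"
  shows "K_pred M k \<iota> (\<lambda>v. v 2 = g (v 0) (v 1))"
proof -
  let ?S = "{\<iota> x @ \<iota> y @ \<iota> (g x y) | x y. True}"
  have "map (\<lambda>j. \<iota> (v (j div k)) ! (j mod k)) [0..<3 * k] \<in> ?S \<longleftrightarrow> v 2 = g (v 0) (v 1)" for v
    unfolding map_code
    by (simp add: numeral_3_eq_3 numeral_2_eq_2 length_embed inj_eq[OF inj_embed])
  with assms show ?thesis
    unfolding K_pred_def definable_iff_pred
    by (intro exI[of _ "\<lambda>w. map w [0..<3 * k] \<in> ?S"]) auto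
qed

lemma K_pred_add: "K_pred M k \<iota> (\<lambda>v. v 2 = v 0 + v 1)"
  using field unfolding definable_field_def by (intro K_pred_graph) blast

lemma K_pred_mult: "K_pred M k \<iota> (\<lambda>v. v 2 = v 0 * v 1)"
  using field unfolding definable_field_def by (intro K_pred_graph) blast

text \<open>Equality comes from the graph of addition, as \<open>v i = v j + 0\<close>.\<close>

lemma K_pred_eq: "K_pred M k \<iota> (\<lambda>v. v i = v j)"
  using K_pred_subst[OF K_pred_add, of "\<lambda>l. if l = 2 then Inl i else if l = 0 then Inl j else Inr 0"]
  by simp

lemma K_fun_var: "K_fun M k \<iota> (\<lambda>v. v i)"
  unfolding K_fun_def by (rule K_pred_eq)

lemma K_fun_const: "K_fun M k \<iota> (\<lambda>v. c)"
  unfolding K_fun_def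
  using K_pred_subst[OF K_pred_eq[of 0 1], of "\<lambda>l. if l = 0 then Inl 0 else Inr c"] by simp

lemma K_fun_comp2:
  assumes g: "K_pred M k \<iota> (\<lambda>v. v 2 = g (v 0) (v 1))" and "K_fun M k \<iota> s" "K_fun M k \<iota> t"
  shows "K_fun M k \<iota> (\<lambda>v. g (s v) (t v))"
proof -
  \<comment> \<open>In \<open>R\<close>, position 0 holds the value of \<open>t\<close>, position 1
    that of \<open>s\<close>, position 2 the result, and the arguments start at 3. \<open>P\<close>
    is the stage after position 0 has been quantified.\<close>
  define R where "R u \<longleftrightarrow> u 0 = t (\<lambda>i. u (i + 3)) \<and> u 2 = g (u 1) (u 0)" for u
  have "K_pred M k \<iota> R"
    unfolding R_def
    using K_pred_ren[OF assms(3)[unfolded K_fun_def], of "\<lambda>i. if i = 0 then 0 else i + 2"]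
      K_pred_ren[OF g, of "\<lambda>i. if i = 2 then 2 else 1 - i"]
    by (intro K_pred_conj) (simp_all add: numeral_3_eq_3)
  note R = K_pred_ex[OF this]
  define P where "P u \<longleftrightarrow> u 0 = s (\<lambda>i. u (i + 2)) \<and> (\<exists>b. R (case_nat b u))" for u
  have "K_pred M k \<iota> P"
    unfolding P_def
    using K_pred_ren[OF assms(2)[unfolded K_fun_def], of "\<lambda>i. if i = 0 then 0 else i + 1"] R
    by (intro K_pred_conj) simp_all
  from K_pred_ex[OF this] show ?thesis
    unfolding K_fun_def P_def R_def by (simp add: numeral_3_eq_3 numeral_2_eq_2)
qed

lemma K_fun_polyfun:
  "polyfun n f \<Longrightarrow> K_fun M k \<iota> (\<lambda>v. f (map v [0..<n]))"
proof (induction rule: polyfun.induct)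
  case (polyfun_nth i)
  then show ?case using K_fun_var by simp
qed (auto intro: K_fun_const K_fun_comp2 K_pred_add K_pred_mult)

lemma K_pred_fun_eq:
  assumes "K_fun M k \<iota> s" "K_fun M k \<iota> t"
  shows "K_pred M k \<iota> (\<lambda>v. s v = t v)"
  using K_pred_ex[OF K_pred_conj[OF assms[unfolded K_fun_def]]] by simp

lemma K_pred_all_less:
  fixes n :: nat
  assumes "\<And>i. i < n \<Longrightarrow> K_pred M k \<iota> (P i)"
  shows "K_pred M k \<iota> (\<lambda>v. \<forall>i<n. P i v)"
proof -
  have "\<forall>i. \<exists>Q. i < n \<longrightarrow> definable_pred M Q \<and> (\<forall>v. P i v \<longleftrightarrow> Q (\<lambda>j. \<iota> (v (j div k)) ! (j mod k)))"
    using assms unfolding K_pred_def by blast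
  then obtain Q where Q: "\<And>i. i < n \<Longrightarrow> definable_pred M (Q i)"
    "\<And>i v. i < n \<Longrightarrow> P i v \<longleftrightarrow> Q i (\<lambda>j. \<iota> (v (j div k)) ! (j mod k))"
    by metis
  then show ?thesis
    unfolding K_pred_def
    by (intro exI[of _ "\<lambda>w. \<forall>i<n. Q i w"]) (simp add: definable_pred_all_less)
qed

lemma K_definableI:
  assumes X: "X \<subseteq> K_power n" and pred: "K_pred M k \<iota> (\<lambda>v. map v [0..<n] \<in> X)"
  shows "K_definable M k \<iota> n X"
proof -
  let ?D = "(\<lambda>xs. concat (map \<iota> xs)) ` X"
  from pred obtain Q where Q: "definable_pred M Q"
    "\<And>v. map v [0..<n] \<in> X \<longleftrightarrow> Q (\<lambda>j. \<iota> (v (j div k)) ! (j mod k))"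
    unfolding K_pred_def by blast
  \<comment> \<open>From position \<open>n * k\<close> on the entries are replaced by the code of 0,
    so that a \<open>w\<close> starting with the code of a list of length \<open>n\<close> becomes
    the code of a full valuation, where \<open>Q\<close> has a meaning. The first conjunct of
    \<open>R\<close> says that \<open>w\<close> does start with such a code.\<close>
  define trunc where
    "trunc w = case_sum w id \<circ> (\<lambda>j. if j < n * k then Inl j else Inr (\<iota> 0 ! (j mod k)))" for w
  define R where
    "R w \<longleftrightarrow> (\<forall>i<n. map (\<lambda>j. w (i * k + j)) [0..<k] \<in> range \<iota>) \<and> Q (trunc w)" for w
  have "definable M k (range \<iota>)" using field unfolding definable_field_def by blast
  then have "definable_pred M (\<lambda>w. map (\<lambda>j. w (i * k + j)) [0..<k] \<in> range \<iota>)" for i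
    unfolding definable_iff_pred using definable_pred_ren by blast
  then have "definable_pred M R"
    unfolding R_def trunc_def
    by (intro definable_pred_conj definable_pred_all_less definable_pred_subst Q(1))
  moreover have "map w [0..<n * k] \<in> ?D \<longleftrightarrow> R w" for w
  proof
    assume "map w [0..<n * k] \<in> ?D"
    then obtain xs where xs: "xs \<in> X" "map w [0..<n * k] = concat (map \<iota> xs)" by blast
    define v where "v i = (if i < n then xs ! i else 0)" for i
    have mv: "map v [0..<n] = xs"
      using xs(1) X by (intro nth_equalityI) (auto simp: v_def K_power_def)
    have w: "w j = \<iota> (v (j div k)) ! (j mod k)" if "j < n * k" for j
    proof -
      have "map w [0..<n * k] = map (\<lambda>j. \<iota> (v (j div k)) ! (j mod k)) [0..<n * k]"
        unfolding map_code mv xs(2) ..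
      then show ?thesis using that by simp
    qed
    have lt: "i * k + j < n * k" if "i < n" "j < k" for i j
    proof -
      have "i * k + j < Suc i * k" using that by simp
      also have "\<dots> \<le> n * k" using that by (intro mult_right_mono) auto
      finally show ?thesis .
    qed
    have "map (\<lambda>j. w (i * k + j)) [0..<k] = \<iota> (v i)" if "i < n" for i
      using that by (intro nth_equalityI) (auto simp: length_embed w lt)
    moreover have "trunc w = (\<lambda>j. \<iota> (v (j div k)) ! (j mod k))"
      using embed_dim_pos by (auto simp: trunc_def fun_eq_iff w v_def less_mult_imp_div_less div_less_iff_less_mult)
    ultimately show "R w" unfolding R_def using Q(2)[of v] mv xs(1) by auto
  next
    assume R: "R w"
    then have "\<forall>i. \<exists>x. i < n \<longrightarrow> map (\<lambda>j. w (i * k + j)) [0..<k] = \<iota> x" unfolding R_def by blast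
    then obtain u where u: "\<And>i. i < n \<Longrightarrow> map (\<lambda>j. w (i * k + j)) [0..<k] = \<iota> (u i)" by metis
    define v where "v i = (if i < n then u i else 0)" for i
    have w: "w j = \<iota> (v (j div k)) ! (j mod k)" if "j < n * k" for j
    proof -
      have "j div k < n" using that by (simp add: less_mult_imp_div_less)
      then have "\<iota> (v (j div k)) ! (j mod k) = map (\<lambda>i. w (j div k * k + i)) [0..<k] ! (j mod k)"
        using u by (simp add: v_def)
      also have "\<dots> = w j" using embed_dim_pos by simp
      finally show ?thesis by simp
    qed
    have "trunc w = (\<lambda>j. \<iota> (v (j div k)) ! (j mod k))"
      using embed_dim_pos by (auto simp: trunc_def fun_eq_iff w v_def less_mult_imp_div_less div_less_iff_less_mult)
    with R have "map v [0..<n] \<in> X" unfolding R_def Q(2) by simp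
    moreover have "map w [0..<n * k] = concat (map \<iota> (map v [0..<n]))"
      unfolding map_code[symmetric] by (auto simp: w)
    ultimately show "map w [0..<n * k] \<in> ?D" by blast
  qed
  moreover have "length (concat (map \<iota> xs)) = n * k" if "xs \<in> X" for xs
    using that X length_embed by (auto simp: length_concat K_power_def comp_def sum_list_triv)
  ultimately show ?thesis
    unfolding K_definable_def definable_iff_pred using X by auto
qed

section \<open>Definability of nonvanishing sets, graphs and images of polynomial maps\<close>

lemma K_pred_nonzero:
  assumes "polyfun n f"
  shows "K_pred M k \<iota> (\<lambda>v. map v [0..<n] \<in> {xs \<in> K_power n. f xs \<noteq> 0})"
  using K_pred_not[OF K_pred_fun_eq[OF K_fun_polyfun[OF assms] K_fun_const[of 0]]]
  by (simp add: K_power_def)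

lemma K_pred_polymap_graph:
  assumes "K_pred M k \<iota> (\<lambda>v. map v [0..<m] \<in> X)" and "\<And>i. i < n \<Longrightarrow> polyfun m (f i)"
  shows "K_pred M k \<iota>
    (\<lambda>v. map v [0..<m] \<in> X \<and> (\<forall>i<n. v (m + i) = f i (map v [0..<m])))"
  using assms by (intro K_pred_conj K_pred_all_less K_pred_fun_eq K_fun_var K_fun_polyfun)

lemma K_definable_polymap_graph:
  assumes X: "X \<subseteq> K_power m" "K_pred M k \<iota> (\<lambda>v. map v [0..<m] \<in> X)"
    and f: "\<And>i. i < n \<Longrightarrow> polyfun m (f i)"
  shows "K_definable M k \<iota> (m + n) {xs @ map (\<lambda>i. f i xs) [0..<n] | xs. xs \<in> X}"
proof (rule K_definableI)
  have "map v [0..<m + n] \<in> {xs @ map (\<lambda>i. f i xs) [0..<n] | xs. xs \<in> X} \<longleftrightarrow>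
      map v [0..<m] \<in> X \<and> (\<forall>i<n. v (m + i) = f i (map v [0..<m]))" (is "?l v \<longleftrightarrow> ?r v") for v
  proof
    have split: "map v [0..<m + n] = map v [0..<m] @ map (\<lambda>i. v (m + i)) [0..<n]"
      by (rule nth_equalityI) (auto simp: nth_append)
    { assume "?l v"
      then obtain xs where "xs \<in> X" "map v [0..<m] @ map (\<lambda>i. v (m + i)) [0..<n] = xs @ map (\<lambda>i. f i xs) [0..<n]"
        unfolding split by blast
      moreover from this have "length xs = m" using X(1) by (auto simp: K_power_def)
      ultimately show "?r v" by auto }
    { assume "?r v"
      then show "?l v" unfolding split by (auto intro!: exI[of _ "map v [0..<m]"]) }
  qed
  with K_pred_polymap_graph[OF X(2) f] show "K_pred M k \<iota> (\<lambda>v. map v [0..<m + n] \<in>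
      {xs @ map (\<lambda>i. f i xs) [0..<n] | xs. xs \<in> X})" by simp
qed (use X(1) in \<open>auto simp: K_power_def\<close>)

text \<open>The image is a projection of the graph; the source coordinates come first, so
  \<open>K_pred_ex_list\<close> removes exactly these.\<close>

lemma K_definable_polymap_image:
  assumes X: "X \<subseteq> K_power m" "K_pred M k \<iota> (\<lambda>v. map v [0..<m] \<in> X)"
    and f: "\<And>i. i < n \<Longrightarrow> polyfun m (f i)"
  shows "K_definable M k \<iota> n ((\<lambda>xs. map (\<lambda>i. f i xs) [0..<n]) ` X)"
proof (rule K_definableI)
  have "map v [0..<n] \<in> (\<lambda>xs. map (\<lambda>i. f i xs) [0..<n]) ` X \<longleftrightarrow>
      (\<exists>xs. length xs = m \<and> (let u = (\<lambda>i. if i < m then xs ! i else v (i - m)) in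
         map u [0..<m] \<in> X \<and> (\<forall>i<n. u (m + i) = f i (map u [0..<m]))))" (is "?l v \<longleftrightarrow> ?r v") for v
  proof -
    have "map (\<lambda>i. if i < m then xs ! i else v (i - m)) [0..<m] = xs" if "length xs = m" for xs
      using that by (intro nth_equalityI) auto
    then have "?r v \<longleftrightarrow> (\<exists>xs. length xs = m \<and> xs \<in> X \<and> (\<forall>i<n. v i = f i xs))"
      by (auto simp: Let_def cong: conj_cong)
    also have "\<dots> \<longleftrightarrow> ?l v"
      using X(1) by (auto simp: K_power_def image_iff list_eq_iff_nth_eq)
    finally show ?thesis by simp
  qed
  with K_pred_ex_list[OF K_pred_polymap_graph[OF X(2) f], where m = m]
  show "K_pred M k \<iota> (\<lambda>v. map v [0..<n] \<in> (\<lambda>xs. map (\<lambda>i. f i xs) [0..<n]) ` X)"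
    by (simp add: Let_def)
qed (auto simp: K_power_def)

end


section \<open>Continuity of polynomial maps\<close>

context
  fixes \<tau> :: "'k::field topology"
  assumes top: "field_topology \<tau>"
begin

lemma topspace_field_topology: "topspace \<tau> = UNIV"
  using top unfolding field_topology_def by blast

lemma continuous_map_field_add:
  assumes "continuous_map T \<tau> f" "continuous_map T \<tau> g"
  shows "continuous_map T \<tau> (\<lambda>x. f x + g x)"
proof -
  have "continuous_map (prod_topology \<tau> \<tau>) \<tau> (\<lambda>(x, y). x + y)"
    using top unfolding field_topology_def by blast
  from continuous_map_compose[OF continuous_map_pairedI[OF assms] this]
  show ?thesis by (simp add: comp_def)
qed

lemma continuous_map_field_mult:
  assumes "continuous_map T \<tau> f" "continuous_map T \<tau> g"
  shows "continuous_map T \<tau> (\<lambda>x. f x * g x)"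
proof -
  have "continuous_map (prod_topology \<tau> \<tau>) \<tau> (\<lambda>(x, y). x * y)"
    using top unfolding field_topology_def by blast
  from continuous_map_compose[OF continuous_map_pairedI[OF assms] this]
  show ?thesis by (simp add: comp_def)
qed

lemma continuous_map_polyfun:
  assumes "polyfun n f" and "\<And>i. i < n \<Longrightarrow> continuous_map T \<tau> (\<lambda>x. g x ! i)"
  shows "continuous_map T \<tau> (\<lambda>x. f (g x))"
  using assms
  by (induction rule: polyfun.induct)
     (auto intro: continuous_map_field_add continuous_map_field_mult simp: topspace_field_topology)

lemma topspace_power_topology: "topspace (power_topology \<tau> n) = K_power n"
  unfolding power_topology_def topspace_pullback_topology by (auto simp: topspace_field_topology)

lemma continuous_map_nth:
  assumes "i < n"
  shows "continuous_map (power_topology \<tau> n) \<tau> (\<lambda>xs. xs ! i)"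
proof -
  have "continuous_map (power_topology \<tau> n) \<tau>
      ((\<lambda>h. h i) \<circ> (\<lambda>xs. \<lambda>i\<in>{..<n}. xs ! i))"
    unfolding power_topology_def
    using assms by (intro continuous_map_pullback continuous_map_product_projection) simp
  with assms show ?thesis by (simp add: comp_def)
qed

lemma continuous_map_into_power:
  assumes "\<And>x. x \<in> topspace T \<Longrightarrow> length (g x) = n"
    and "\<And>i. i < n \<Longrightarrow> continuous_map T \<tau> (\<lambda>x. g x ! i)"
  shows "continuous_map T (power_topology \<tau> n) g"
  unfolding power_topology_def
proof (rule continuous_map_pullback')
  show "continuous_map T (product_topology (\<lambda>_. \<tau>) {..<n}) ((\<lambda>xs. \<lambda>i\<in>{..<n}. xs ! i) \<circ> g)"
    unfolding continuous_map_componentwise using assms(2) by auto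
qed (use assms(1) in \<open>auto simp: K_power_def\<close>)

lemma topspace_monic_topology: "topspace (monic_topology \<tau> d) = monic_polys d"
  unfolding monic_topology_def topspace_pullback_topology
  by (auto simp: topspace_power_topology K_power_def)

lemma continuous_map_coeff:
  assumes "i < d"
  shows "continuous_map (monic_topology \<tau> d) \<tau> (\<lambda>P. Polynomial.coeff P i)"
proof -
  have "continuous_map (monic_topology \<tau> d) \<tau> ((\<lambda>xs. xs ! i) \<circ> (\<lambda>P. map (Polynomial.coeff P) [0..<d]))"
    unfolding monic_topology_def
    using assms by (intro continuous_map_pullback continuous_map_nth)
  with assms show ?thesis by (simp add: comp_def)
qed

text \<open>\<open>field_topology\<close> contains no separation axiom, so openness of the
  complement of 0 has to be derived. For nonzero \<open>x\<close> the preimage of \<open>U\<close>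
  under multiplication by \<open>u / x\<close> is a neighbourhood of \<open>x\<close> that avoids
  0.\<close>

lemma openin_nonzero_if_nontrivial:
  assumes "openin \<tau> U" "u \<in> U" "0 \<notin> U"
  shows "openin \<tau> (- {0})"
proof -
  have "openin \<tau> {y. y * (u / x) \<in> U}" for x
  proof -
    have "continuous_map \<tau> \<tau> (\<lambda>y. y * (u / x))"
      by (intro continuous_map_field_mult) (auto simp: topspace_field_topology)
    from openin_continuous_map_preimage[OF this assms(1)]
    show ?thesis by (simp add: topspace_field_topology)
  qed
  then have "openin \<tau> (\<Union>x\<in>- {0}. {y. y * (u / x) \<in> U})" by blast
  also have "(\<Union>x\<in>- {0}. {y. y * (u / x) \<in> U}) = - {0}"
    using assms(2,3) by fastforce
  finally show ?thesis .
qed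

lemma openin_polyfun_nonzero:
  assumes "openin \<tau> (- {0})" "polyfun n f" "\<And>i. i < n \<Longrightarrow> continuous_map T \<tau> (\<lambda>x. g x ! i)"
  shows "openin T {x \<in> topspace T. f (g x) \<noteq> 0}"
  using openin_continuous_map_preimage[OF continuous_map_polyfun[OF assms(2,3)] assms(1)]
  by simp

end


section \<open>Matrices with polynomial entries\<close>

lemma polyfun_uminus: "polyfun n f \<Longrightarrow> polyfun n (\<lambda>xs. - f xs)"
  using polyfun_mult[OF polyfun_const[of n "-1"]] by force

lemma polyfun_sum:
  "(\<And>i. i \<in> I \<Longrightarrow> polyfun n (f i)) \<Longrightarrow> polyfun n (\<lambda>xs. \<Sum>i\<in>I. f i xs)"
  by (induction I rule: infinite_finite_induct) (auto intro: polyfun_const polyfun_add)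

lemma polyfun_prod:
  "(\<And>i. i \<in> I \<Longrightarrow> polyfun n (f i)) \<Longrightarrow> polyfun n (\<lambda>xs. \<Prod>i\<in>I. f i xs)"
  by (induction I rule: infinite_finite_induct) (auto intro: polyfun_const polyfun_mult)

lemma polyfun_det:
  assumes A: "\<And>xs. A xs \<in> carrier_mat d d"
    and "\<And>i j. i < d \<Longrightarrow> j < d \<Longrightarrow> polyfun n (\<lambda>xs. A xs $$ (i, j))"
  shows "polyfun n (\<lambda>xs. Determinant.det (A xs))"
  unfolding det_def'[OF A]
  using assms(2) permutes_in_image
  by (intro polyfun_sum polyfun_mult polyfun_const polyfun_prod) fastforce

text \<open>The characteristic polynomial is a determinant over the polynomial ring, so closure
  under products is needed coefficient by coefficient.\<close>

lemma polyfun_coeff_mult: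
  assumes "\<And>l. polyfun n (\<lambda>xs. Polynomial.coeff (p xs) l)" "\<And>l. polyfun n (\<lambda>xs. Polynomial.coeff (q xs) l)"
  shows "polyfun n (\<lambda>xs. Polynomial.coeff (p xs * q xs) l)"
  unfolding coeff_mult by (intro polyfun_sum polyfun_mult assms)

lemma polyfun_coeff_prod:
  assumes "\<And>i l. i \<in> I \<Longrightarrow> polyfun n (\<lambda>xs. Polynomial.coeff (p i xs) l)"
  shows "polyfun n (\<lambda>xs. Polynomial.coeff (\<Prod>i\<in>I. p i xs) l)"
  using assms
proof (induction I arbitrary: l rule: infinite_finite_induct)
  case (insert i I)
  then show ?case by (simp add: polyfun_coeff_mult)
qed (auto intro: polyfun_const)

lemma polyfun_coeff_char_poly:
  assumes A: "\<And>xs. A xs \<in> carrier_mat d d"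
    and "\<And>i j. i < d \<Longrightarrow> j < d \<Longrightarrow> polyfun n (\<lambda>xs. A xs $$ (i, j))"
  shows "polyfun n (\<lambda>xs. Polynomial.coeff (char_poly (A xs)) l)"
proof -
  have "polyfun n (\<lambda>xs. Polynomial.coeff (char_poly_matrix (A xs) $$ (i, j)) l)"
    if ij: "i < d" "j < d" for i j l
  proof -
    have "char_poly_matrix (A xs) $$ (i, j) = (if i = j then [:0, 1:] else 0) + [:- A xs $$ (i, j):]" for xs
      using ij A[of xs] unfolding char_poly_matrix_def by auto
    then show ?thesis
      using assms(2)[OF ij]
      by (cases l) (auto intro!: polyfun_add polyfun_const polyfun_uminus)
  qed
  then show ?thesis
    unfolding char_poly_def det_def'[OF char_poly_matrix_closed[OF A]] coeff_sum
    using permutes_in_image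
    by (intro polyfun_sum polyfun_coeff_mult polyfun_coeff_prod polyfun_const) fastforce
qed

lemma polyfun_pow_mat:
  assumes A: "\<And>xs. A xs \<in> carrier_mat d d"
    and "\<And>i j. i < d \<Longrightarrow> j < d \<Longrightarrow> polyfun n (\<lambda>xs. A xs $$ (i, j))"
  shows "i < d \<Longrightarrow> j < d \<Longrightarrow> polyfun n (\<lambda>xs. (A xs ^\<^sub>m l) $$ (i, j))"
proof (induction l arbitrary: i j)
  case 0
  have "(A xs ^\<^sub>m 0) $$ (i, j) = (if i = j then 1 else 0)" for xs
    using 0 A[of xs] by auto
  then show ?case by (simp add: polyfun_const)
next
  case (Suc l)
  have "(A xs ^\<^sub>m Suc l) $$ (i, j) = (\<Sum>m=0..<d. (A xs ^\<^sub>m l) $$ (i, m) * A xs $$ (m, j))" for xs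
    using Suc.prems A[of xs] pow_carrier_mat[OF A[of xs], of l] by (simp add: scalar_prod_def)
  then show ?case
    using Suc assms(2) by (auto intro!: polyfun_sum polyfun_mult)
qed


section \<open>Tschirnhaus transformations\<close>

text \<open>Lists \<open>ps\<close> and \<open>gs\<close> of length \<open>n\<close> encode \<open>P = X\<^sup>n + ps\<^sub>n\<^sub>-\<^sub>1 X\<^sup>n\<^sup>-\<^sup>1 + \<dots> + ps\<^sub>0\<close> and
  \<open>g = gs\<^sub>n\<^sub>-\<^sub>1 X\<^sup>n\<^sup>-\<^sup>1 + \<dots> + gs\<^sub>0\<close>. The matrix \<open>poly_mat n gs (companion n ps)\<close> is that of
  multiplication by \<open>g\<close> on \<open>K[X]/(P)\<close>, and the determinant of its \<open>krylov\<close> matrix is nonzero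
  iff \<open>g\<close> generates this algebra.\<close>

definition companion :: "nat \<Rightarrow> 'a::comm_ring_1 list \<Rightarrow> 'a mat" where
  "companion n ps = Matrix.mat n n
     (\<lambda>(i, j). if Suc i = n then - ps ! j else if j = Suc i then 1 else 0)"

definition poly_mat :: "nat \<Rightarrow> 'a::comm_ring_1 list \<Rightarrow> 'a mat \<Rightarrow> 'a mat" where
  "poly_mat n gs A = Matrix.mat n n (\<lambda>(i, j). \<Sum>l<n. gs ! l * (A ^\<^sub>m l) $$ (i, j))"

definition krylov :: "nat \<Rightarrow> 'a::comm_ring_1 mat \<Rightarrow> 'a mat" where
  "krylov n A = Matrix.mat n n (\<lambda>(i, j). (A ^\<^sub>m i) $$ (0, j))"

lemma companion_carrier [simp]: "companion n ps \<in> carrier_mat n n"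
  and poly_mat_carrier [simp]: "poly_mat n gs A \<in> carrier_mat n n"
  and krylov_carrier [simp]: "krylov n A \<in> carrier_mat n n"
  by (simp_all add: companion_def poly_mat_def krylov_def)

section \<open>Eigenvectors of companion matrices and of polynomials in a matrix\<close>

lemma mult_mat_vec_nth:
  assumes "A \<in> carrier_mat n n" "v \<in> carrier_vec n" "i < n"
  shows "(A *\<^sub>v v) $ i = (\<Sum>j<n. A $$ (i, j) * v $ j)"
  using assms by (simp add: scalar_prod_def atLeast0LessThan)

lemma mult_mat_nth:
  assumes "A \<in> carrier_mat n n" "B \<in> carrier_mat n n" "i < n" "j < n"
  shows "(A * B) $$ (i, j) = (\<Sum>l<n. A $$ (i, l) * B $$ (l, j))"
  using assms by (simp add: scalar_prod_def atLeast0LessThan)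

lemma companion_mult_vec:
  assumes "v \<in> carrier_vec n" "i < n"
  shows "(companion n ps *\<^sub>v v) $ i = (if Suc i = n then - (\<Sum>j<n. ps ! j * v $ j) else v $ Suc i)"
proof -
  have "(companion n ps *\<^sub>v v) $ i = (\<Sum>j<n. companion n ps $$ (i, j) * v $ j)"
    by (rule mult_mat_vec_nth) (use assms in auto)
  also have "\<dots> = (\<Sum>j<n. (if Suc i = n then - ps ! j else if j = Suc i then 1 else 0) * v $ j)"
    using assms(2) by (intro sum.cong) (auto simp: companion_def)
  also have "\<dots> = (if Suc i = n then - (\<Sum>j<n. ps ! j * v $ j) else v $ Suc i)"
  proof (cases "Suc i = n")
    case False
    then have "(\<Sum>j<n. (if j = Suc i then 1 else 0) * v $ j) = (\<Sum>j<n. if j = Suc i then v $ j else 0)"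
      by (intro sum.cong) auto
    with False assms(2) show ?thesis by simp
  qed (simp add: sum_negf)
  finally show ?thesis .
qed

text \<open>Row \<open>i\<close> of the companion matrix holds the coefficients of
  \<open>X * X^i\<close> modulo the polynomial; evaluation at a root \<open>x\<close> turns this
  into the eigenvector equation for the powers of \<open>x\<close>.\<close>

lemma companion_eigenvector:
  fixes x :: "'a::field"
  assumes "n > 0" "x ^ n + (\<Sum>j<n. ps ! j * x ^ j) = 0"
  shows "eigenvector (companion n ps) (Matrix.vec n (\<lambda>i. x ^ i)) x"
proof -
  let ?v = "Matrix.vec n (\<lambda>i. x ^ i)"
  have "?v $ 0 = 1" using assms(1) by simp
  then have "?v \<noteq> 0\<^sub>v n" using assms(1) by (metis index_zero_vec(1) zero_neq_one)
  moreover have "companion n ps *\<^sub>v ?v = x \<cdot>\<^sub>v ?v"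
  proof (rule eq_vecI)
    fix i assume i: "i < dim_vec (x \<cdot>\<^sub>v ?v)"
    then have "(companion n ps *\<^sub>v ?v) $ i =
        (if Suc i = n then - (\<Sum>j<n. ps ! j * ?v $ j) else ?v $ Suc i)"
      by (intro companion_mult_vec) auto
    also have "\<dots> = x * x ^ i"
    proof (cases "Suc i = n")
      case True
      then have "x * x ^ i = x ^ n" by auto
      with True assms(2) show ?thesis by (simp add: neg_eq_iff_add_eq_0 add.commute)
    qed (use i in auto)
    finally show "(companion n ps *\<^sub>v ?v) $ i = (x \<cdot>\<^sub>v ?v) $ i" using i by simp
  qed (simp add: companion_def)
  ultimately show ?thesis unfolding eigenvector_def by (simp add: companion_def)
qed

text \<open>The rows above the last force \<open>v\<close> to be \<open>v $ 0\<close> times the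
  vector of powers of \<open>x\<close>. Hence \<open>v $ 0\<close> is nonzero, and the last row
  gives the equation for \<open>x\<close>.\<close>

lemma companion_eigenvector_root:
  fixes x :: "'a::field"
  assumes ev: "eigenvector (companion n ps) v x"
  shows "x ^ n + (\<Sum>j<n. ps ! j * x ^ j) = 0"
proof -
  from ev have v: "v \<in> carrier_vec n" "v \<noteq> 0\<^sub>v n" "companion n ps *\<^sub>v v = x \<cdot>\<^sub>v v"
    unfolding eigenvector_def by (simp_all add: companion_def)
  have step: "x * v $ i = (if Suc i = n then - (\<Sum>j<n. ps ! j * v $ j) else v $ Suc i)" if "i < n" for i
    using companion_mult_vec[OF v(1) that, of ps] v(1,3) that by simp
  have pow: "v $ i = x ^ i * v $ 0" if "i < n" for i
    using that
  proof (induction i)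
    case (Suc i)
    then show ?case using step[of i] by (simp add: mult.assoc)
  qed simp
  have "n > 0" using v(1,2) by (metis carrier_vecD eq_vecI gr0I index_zero_vec(2) less_nat_zero_code)
  then obtain m where m: "n = Suc m" using gr0_implies_Suc by blast
  have "v $ 0 \<noteq> 0"
  proof (rule notI)
    assume "v $ 0 = 0"
    have "v = 0\<^sub>v n"
    proof (rule eq_vecI)
      fix i assume "i < dim_vec (0\<^sub>v n :: 'a Matrix.vec)"
      with pow[of i] \<open>v $ 0 = 0\<close> show "v $ i = 0\<^sub>v n $ i" by simp
    qed (use v(1) in simp)
    with v(2) show False by simp
  qed
  moreover have "x ^ n * v $ 0 = x * v $ m"
    using pow[of m] m by (simp add: mult.assoc)
  moreover have "(\<Sum>j<n. ps ! j * x ^ j) * v $ 0 = (\<Sum>j<n. ps ! j * v $ j)"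
    unfolding sum_distrib_right
    by (intro sum.cong refl) (metis lessThan_iff mult.assoc pow)
  moreover have "x * v $ m = - (\<Sum>j<n. ps ! j * v $ j)" using step[of m] m by simp
  ultimately have "(x ^ n + (\<Sum>j<n. ps ! j * x ^ j)) * v $ 0 = 0"
    unfolding distrib_right by simp
  with \<open>v $ 0 \<noteq> 0\<close> show ?thesis by simp
qed

text \<open>Unlike an eigenvector, \<open>v\<close> may be zero: the vector \<open>w\<close> in
  \<open>eigenvector_of_commuting\<close> can vanish.\<close>

lemma pow_mat_mult_vec:
  fixes A :: "'a::field mat"
  assumes A: "A \<in> carrier_mat n n" and v: "v \<in> carrier_vec n" "A *\<^sub>v v = c \<cdot>\<^sub>v v"
  shows "A ^\<^sub>m l *\<^sub>v v = c ^ l \<cdot>\<^sub>v v"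
proof (cases "v = 0\<^sub>v n")
  case True
  have "A ^\<^sub>m l *\<^sub>v 0\<^sub>v n = 0\<^sub>v n"
  proof (rule eq_vecI)
    fix i assume "i < dim_vec (0\<^sub>v n :: 'a Matrix.vec)"
    then show "(A ^\<^sub>m l *\<^sub>v 0\<^sub>v n) $ i = 0\<^sub>v n $ i"
      using mult_mat_vec_nth[OF pow_carrier_mat[OF A] zero_carrier_vec, of i l] by simp
  qed (use A in simp)
  with True show ?thesis by auto
next
  case False
  with A v have "eigenvector A v c" unfolding eigenvector_def by simp
  then show ?thesis using eigenvector_pow[OF A] by blast
qed

lemma poly_mat_eigenvector:
  fixes A :: "'a::field mat"
  assumes A: "A \<in> carrier_mat n n" and ev: "eigenvector A v x"
  shows "eigenvector (poly_mat n gs A) v (\<Sum>l<n. gs ! l * x ^ l)"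
proof -
  from A ev have v: "v \<in> carrier_vec n" "v \<noteq> 0\<^sub>v n" unfolding eigenvector_def by auto
  have "(poly_mat n gs A *\<^sub>v v) $ i = (\<Sum>l<n. gs ! l * x ^ l) * v $ i" if i: "i < n" for i
  proof -
    have "(poly_mat n gs A *\<^sub>v v) $ i = (\<Sum>j<n. poly_mat n gs A $$ (i, j) * v $ j)"
      by (rule mult_mat_vec_nth) (use v i in auto)
    also have "\<dots> = (\<Sum>j<n. \<Sum>l<n. gs ! l * ((A ^\<^sub>m l) $$ (i, j) * v $ j))"
      using i by (intro sum.cong) (simp_all add: poly_mat_def sum_distrib_right mult.assoc)
    also have "\<dots> = (\<Sum>l<n. gs ! l * (\<Sum>j<n. (A ^\<^sub>m l) $$ (i, j) * v $ j))"
      unfolding sum_distrib_left by (rule sum.swap)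
    also have "\<dots> = (\<Sum>l<n. gs ! l * (A ^\<^sub>m l *\<^sub>v v) $ i)"
      using mult_mat_vec_nth[OF pow_carrier_mat[OF A] v(1) i] by simp
    also have "\<dots> = (\<Sum>l<n. gs ! l * x ^ l * v $ i)"
      using v i by (simp add: eigenvector_pow[OF A ev] mult.assoc)
    finally show ?thesis by (simp add: sum_distrib_right)
  qed
  then have "poly_mat n gs A *\<^sub>v v = (\<Sum>l<n. gs ! l * x ^ l) \<cdot>\<^sub>v v"
    using v by (intro eq_vecI) (auto simp: poly_mat_def)
  with v show ?thesis unfolding eigenvector_def by (simp add: poly_mat_def)
qed

lemma pow_mat_commute:
  assumes A: "A \<in> carrier_mat n n"
  shows "A ^\<^sub>m l * A = A * A ^\<^sub>m l"
proof (induction l)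
  case (Suc l)
  have "A ^\<^sub>m Suc l * A = A * A ^\<^sub>m l * A" using Suc by simp
  also have "\<dots> = A * (A ^\<^sub>m l * A)" using A by (intro assoc_mult_mat) auto
  finally show ?case by simp
qed (use A in simp)

lemma poly_mat_commute:
  assumes A: "A \<in> carrier_mat n n"
  shows "poly_mat n gs A * A = A * poly_mat n gs A"
proof (rule eq_matI)
  fix i j assume "i < dim_row (A * poly_mat n gs A)" "j < dim_col (A * poly_mat n gs A)"
  then have ij: "i < n" "j < n" using A by (auto simp: poly_mat_def)
  have "(poly_mat n gs A * A) $$ (i, j) = (\<Sum>m<n. poly_mat n gs A $$ (i, m) * A $$ (m, j))"
    by (rule mult_mat_nth) (use A ij in auto)
  also have "\<dots> = (\<Sum>m<n. \<Sum>l<n. gs ! l * ((A ^\<^sub>m l) $$ (i, m) * A $$ (m, j)))"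
    using ij by (intro sum.cong) (simp_all add: poly_mat_def sum_distrib_right mult.assoc)
  also have "\<dots> = (\<Sum>l<n. gs ! l * (\<Sum>m<n. (A ^\<^sub>m l) $$ (i, m) * A $$ (m, j)))"
    unfolding sum_distrib_left by (rule sum.swap)
  also have "\<dots> = (\<Sum>l<n. gs ! l * (A ^\<^sub>m l * A) $$ (i, j))"
    by (intro sum.cong refl) (simp only: mult_mat_nth[OF pow_carrier_mat[OF A] A ij])
  also have "\<dots> = (\<Sum>l<n. gs ! l * (\<Sum>m<n. A $$ (i, m) * (A ^\<^sub>m l) $$ (m, j)))"
    by (intro sum.cong refl)
       (simp only: pow_mat_commute[OF A] mult_mat_nth[OF A pow_carrier_mat[OF A] ij])
  also have "\<dots> = (\<Sum>l<n. \<Sum>m<n. A $$ (i, m) * (gs ! l * (A ^\<^sub>m l) $$ (m, j)))"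
    by (simp add: sum_distrib_left mult.left_commute)
  also have "\<dots> = (\<Sum>m<n. A $$ (i, m) * (\<Sum>l<n. gs ! l * (A ^\<^sub>m l) $$ (m, j)))"
    unfolding sum_distrib_left by (rule sum.swap)
  also have "\<dots> = (\<Sum>m<n. A $$ (i, m) * poly_mat n gs A $$ (m, j))"
    using ij by (intro sum.cong) (simp_all add: poly_mat_def)
  also have "\<dots> = (A * poly_mat n gs A) $$ (i, j)"
    by (rule mult_mat_nth[symmetric]) (use A ij in auto)
  finally show "(poly_mat n gs A * A) $$ (i, j) = (A * poly_mat n gs A) $$ (i, j)" .
qed (use A in \<open>auto simp: poly_mat_def\<close>)

text \<open>The rows are the first rows of the powers of \<open>A\<close>, so the product lists the
  first entries of \<open>A^i v\<close>. On the eigenspace of \<open>c\<close> the Krylov matrix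
  therefore has rank at most one.\<close>

lemma krylov_mult_vec:
  fixes A :: "'a::field mat"
  assumes A: "A \<in> carrier_mat n n" and v: "v \<in> carrier_vec n" "A *\<^sub>v v = c \<cdot>\<^sub>v v"
  shows "krylov n A *\<^sub>v v = v $ 0 \<cdot>\<^sub>v Matrix.vec n (\<lambda>i. c ^ i)"
proof (rule eq_vecI)
  fix i assume "i < dim_vec (v $ 0 \<cdot>\<^sub>v Matrix.vec n (\<lambda>i. c ^ i))"
  then have i: "i < n" by simp
  have "(krylov n A *\<^sub>v v) $ i = (\<Sum>j<n. krylov n A $$ (i, j) * v $ j)"
    by (rule mult_mat_vec_nth) (use v i in auto)
  also have "\<dots> = (\<Sum>j<n. (A ^\<^sub>m i) $$ (0, j) * v $ j)"
    using i by (intro sum.cong) (auto simp: krylov_def)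
  also have "\<dots> = (A ^\<^sub>m i *\<^sub>v v) $ 0"
    by (rule mult_mat_vec_nth[symmetric]) (use A v i in auto)
  also have "\<dots> = c ^ i * v $ 0"
    using pow_mat_mult_vec[OF assms] v(1) i by simp
  finally show "(krylov n A *\<^sub>v v) $ i = (v $ 0 \<cdot>\<^sub>v Matrix.vec n (\<lambda>i. c ^ i)) $ i"
    using i by simp
qed (simp add: krylov_def)

text \<open>Invertibility of the Krylov matrix makes the eigenspaces of \<open>A\<close> one-dimensional, and \<open>C\<close>
  preserves them.\<close>

lemma eigenvector_of_commuting:
  fixes A :: "'a::field mat"
  assumes A: "A \<in> carrier_mat n n" and C: "C \<in> carrier_mat n n" and comm: "A * C = C * A"
    and kry: "Determinant.det (krylov n A) \<noteq> 0" and ev: "eigenvector A u c"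
  shows "\<exists>x. eigenvector C u x"
proof -
  from A ev have u: "u \<in> carrier_vec n" "u \<noteq> 0\<^sub>v n" "A *\<^sub>v u = c \<cdot>\<^sub>v u"
    unfolding eigenvector_def by auto
  have inj: "z = 0\<^sub>v n" if "z \<in> carrier_vec n" "krylov n A *\<^sub>v z = 0\<^sub>v n" for z
    using det_0_iff_vec_prod_zero_field[OF krylov_carrier[of n A]] kry that by blast
  define w where "w = C *\<^sub>v u"
  have w: "w \<in> carrier_vec n" using C u unfolding w_def by simp
  have "A *\<^sub>v w = (A * C) *\<^sub>v u" unfolding w_def using A C u by simp
  also have "\<dots> = C *\<^sub>v (A *\<^sub>v u)" unfolding comm using A C u by simp
  also have "\<dots> = c \<cdot>\<^sub>v w" unfolding u(3) w_def using C u by (simp add: mult_mat_vec)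
  finally have Aw: "A *\<^sub>v w = c \<cdot>\<^sub>v w" .
  let ?e = "Matrix.vec n (\<lambda>i. c ^ i)"
  have Ku: "krylov n A *\<^sub>v u = u $ 0 \<cdot>\<^sub>v ?e" and Kw: "krylov n A *\<^sub>v w = w $ 0 \<cdot>\<^sub>v ?e"
    using krylov_mult_vec[OF A] u w Aw by blast+
  have u0: "u $ 0 \<noteq> 0"
  proof
    assume "u $ 0 = 0"
    with Ku have "krylov n A *\<^sub>v u = 0\<^sub>v n" by (auto intro: eq_vecI)
    with inj u show False by blast
  qed
  \<comment> \<open>This combination of \<open>u\<close> and \<open>w\<close> has first entry 0, so
    the Krylov matrix kills it; its vanishing makes \<open>w\<close> a multiple of
    \<open>u\<close>.\<close>
  define z where "z = u $ 0 \<cdot>\<^sub>v w - w $ 0 \<cdot>\<^sub>v u"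
  have "krylov n A *\<^sub>v z = u $ 0 \<cdot>\<^sub>v (krylov n A *\<^sub>v w) - w $ 0 \<cdot>\<^sub>v (krylov n A *\<^sub>v u)"
    unfolding z_def using u w
    by (simp add: mult_minus_distrib_mat_vec[OF krylov_carrier] mult_mat_vec[OF krylov_carrier])
  also have "\<dots> = 0\<^sub>v n" unfolding Ku Kw by (auto intro!: eq_vecI simp: mult_ac)
  finally have z: "z = 0\<^sub>v n" using inj u w unfolding z_def by simp
  have "w = (w $ 0 / u $ 0) \<cdot>\<^sub>v u"
  proof (rule eq_vecI)
    fix i assume "i < dim_vec ((w $ 0 / u $ 0) \<cdot>\<^sub>v u)"
    then have i: "i < n" using u by simp
    have "z $ i = u $ 0 * w $ i - w $ 0 * u $ i" unfolding z_def using i u w by simp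
    with z i have "u $ 0 * w $ i = w $ 0 * u $ i" by simp
    with u0 show "w $ i = ((w $ 0 / u $ 0) \<cdot>\<^sub>v u) $ i" using i u by (simp add: field_simps)
  qed (use u w in simp)
  then have "eigenvector C u (w $ 0 / u $ 0)"
    unfolding eigenvector_def using u C by (simp add: w_def)
  then show ?thesis by blast
qed

text \<open>Row 0 of the \<open>i\<close>-th power expresses \<open>X^i\<close> in the monomial
  basis, and for \<open>i < n\<close> this is a basis vector.\<close>

lemma krylov_companion:
  "krylov n (companion n ps) = 1\<^sub>m n"
proof (rule eq_matI)
  have row: "j < n \<Longrightarrow> (companion n ps ^\<^sub>m i) $$ (0, j) = (if i = j then 1 else 0)" if "i < n" for i j
    using that
  proof (induction i arbitrary: j)
    case 0
    then show ?case by (simp add: companion_def)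
  next
    case (Suc i)
    have "(companion n ps ^\<^sub>m Suc i) $$ (0, j) = (companion n ps ^\<^sub>m i * companion n ps) $$ (0, j)"
      by simp
    also have "\<dots> = (\<Sum>l<n. (companion n ps ^\<^sub>m i) $$ (0, l) * companion n ps $$ (l, j))"
      by (rule mult_mat_nth) (use Suc.prems in auto)
    also have "\<dots> = (\<Sum>l<n. if i = l then companion n ps $$ (l, j) else 0)"
      using Suc by (intro sum.cong) auto
    also have "\<dots> = companion n ps $$ (i, j)" using Suc.prems by simp
    also have "\<dots> = (if Suc i = j then 1 else 0)" using Suc.prems by (auto simp: companion_def)
    finally show ?case .
  qed
  fix i j assume "i < dim_row (1\<^sub>m n :: 'a mat)" "j < dim_col (1\<^sub>m n :: 'a mat)"
  then show "krylov n (companion n ps) $$ (i, j) = 1\<^sub>m n $$ (i, j)"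
    using row by (simp add: krylov_def)
qed (simp_all add: krylov_def)

text \<open>The list encodes \<open>g = X\<close>, whose matrix is the companion matrix itself; it
  witnesses that generators exist. For \<open>n = 1\<close> the list is \<open>[0]\<close>, but the
  algebra is then the base field and every element generates it.\<close>

lemma det_krylov_generator:
  fixes ps :: "'a::field list"
  assumes "n > 0"
  shows "Determinant.det (krylov n (poly_mat n (map (\<lambda>l. if l = 1 then 1 else 0) [0..<n]) (companion n ps))) \<noteq> 0"
proof (cases "n = 1")
  case True
  have "krylov 1 A = 1\<^sub>m 1" if "A \<in> carrier_mat 1 1" for A :: "'a mat"
    using that by (auto simp: krylov_def)
  with True show ?thesis by (simp only: poly_mat_carrier) (simp add: det_one)
next
  case False
  with assms have n: "1 < n" by simp
  let ?gs = "map (\<lambda>l. if l = 1 then 1 else 0) [0..<n] :: 'a list"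
  have "poly_mat n ?gs (companion n ps) = companion n ps"
  proof (rule eq_matI)
    fix i j assume "i < dim_row (companion n ps)" "j < dim_col (companion n ps)"
    then have ij: "i < n" "j < n" by (auto simp: companion_def)
    have "poly_mat n ?gs (companion n ps) $$ (i, j) =
        (\<Sum>l<n. ?gs ! l * (companion n ps ^\<^sub>m l) $$ (i, j))"
      using ij unfolding poly_mat_def by (subst index_mat) simp_all
    also have "\<dots> = (\<Sum>l<n. if l = 1 then (companion n ps ^\<^sub>m l) $$ (i, j) else 0)"
      by (intro sum.cong) auto
    also have "\<dots> = (companion n ps ^\<^sub>m 1) $$ (i, j)" using n by simp
    also have "\<dots> = companion n ps $$ (i, j)" using ij by (simp add: companion_def)
    finally show "poly_mat n ?gs (companion n ps) $$ (i, j) = companion n ps $$ (i, j)" .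
  qed (auto simp: companion_def poly_mat_def)
  then show ?thesis by (simp add: krylov_companion det_one)
qed


section \<open>Finiteness of the fibres\<close>

text \<open>An element of least degree among the nonzero ones of the ideal of \<open>p\<close> and
  \<open>q\<close> divides both, hence is a unit.\<close>

lemma poly_bezout_coprime:
  fixes p q :: "'a::field poly"
  assumes "coprime p q"
  shows "\<exists>a b. a * p + b * q = 1"
proof -
  define I where "I = {a * p + b * q | a b. True}"
  have "p \<in> I" "q \<in> I"
    unfolding I_def by (rule CollectI, rule exI[of _ 1], rule exI[of _ 0], simp,
        rule CollectI, rule exI[of _ 0], rule exI[of _ 1], simp)
  have nz: "\<exists>d. d \<in> I \<and> d \<noteq> 0"
  proof (rule ccontr)
    assume "\<not> ?thesis"
    with \<open>p \<in> I\<close> \<open>q \<in> I\<close> have "p = 0" "q = 0" by auto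
    with assms show False by simp
  qed
  obtain d where d: "d \<in> I" "d \<noteq> 0"
    and min: "\<And>e. e \<in> I \<Longrightarrow> e \<noteq> 0 \<Longrightarrow> Polynomial.degree d \<le> Polynomial.degree e"
    using ex_has_least_nat[of "\<lambda>d. d \<in> I \<and> d \<noteq> 0" _ Polynomial.degree] nz by blast
  obtain a b where ab: "d = a * p + b * q" using d(1) unfolding I_def by blast
  have "d dvd f" if f: "f \<in> I" for f
  proof -
    obtain u v where uv: "f = u * p + v * q" using f unfolding I_def by blast
    have "f mod d = f - (f div d) * d" by (simp add: minus_div_mult_eq_mod)
    also have "\<dots> = (u - (f div d) * a) * p + (v - (f div d) * b) * q"
      unfolding uv ab by (simp add: algebra_simps)
    finally have "f mod d \<in> I" unfolding I_def by blast
    then have "f mod d = 0"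
      using min degree_mod_less[OF d(2), of f] by (meson leD)
    then show ?thesis by (simp add: mod_eq_0_iff_dvd)
  qed
  with \<open>p \<in> I\<close> \<open>q \<in> I\<close> assms have "is_unit d" by (meson coprime_common_divisor)
  then obtain c where c: "1 = d * c" by (elim dvdE)
  have "(c * a) * p + (c * b) * q = 1" unfolding c ab by (simp add: algebra_simps)
  then show ?thesis by blast
qed

interpretation to_ac: inj_comm_ring_hom "to_ac :: 'k::field \<Rightarrow> 'k alg_closure"
  by standard auto

text \<open>A Bezout identity for \<open>p\<close> and its derivative carries over to the algebraic
  closure by applying \<open>to_ac\<close> to it. There it excludes double roots, so the linear
  factors are distinct.\<close>

lemma card_roots_separable:
  fixes p :: "'k::field poly"
  assumes "separable_poly p" "p \<noteq> 0"
  shows "card {x. poly (map_poly to_ac p) x = 0} = Polynomial.degree p"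
proof -
  let ?q = "map_poly to_ac p"
  interpret poly_hom: map_poly_comm_ring_hom "to_ac :: 'k \<Rightarrow> 'k alg_closure" ..
  obtain a b where ab: "a * p + b * pderiv p = 1"
    using poly_bezout_coprime assms(1) unfolding separable_poly_def by blast
  have "map_poly to_ac (pderiv p) = pderiv ?q"
    by (intro poly_eqI) (simp add: coeff_pderiv coeff_map_poly)
  with arg_cong[OF ab, of "map_poly to_ac"]
  have bez: "map_poly to_ac a * ?q + map_poly to_ac b * pderiv ?q = 1"
    by (simp add: poly_hom.hom_add poly_hom.hom_mult)
  have q0: "?q \<noteq> 0" using assms(2) by simp
  then obtain A where A: "size A = Polynomial.degree ?q"
    "?q = Polynomial.smult (Polynomial.lead_coeff ?q) (\<Prod>x\<in>#A. [:-x, 1:])"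
    using alg_closed_imp_factorization by blast
  have lead: "Polynomial.lead_coeff ?q \<noteq> 0" using q0 by simp
  have roots: "{x. poly ?q x = 0} = set_mset A"
    by (subst A(2)) (use lead in \<open>auto simp: poly_prod_mset image_iff\<close>)
  have count: "count A x = 1" if x: "x \<in># A" for x
  proof (rule ccontr)
    assume "count A x \<noteq> 1"
    moreover have "count A x > 0" using x by simp
    ultimately have "x \<in># A - {#x#}" by (metis count_diff count_single in_diff_count less_one nat_neq_iff not_less)
    then obtain B where "A - {#x#} = add_mset x B" by (meson multi_member_split)
    with x have B: "A = add_mset x (add_mset x B)" by (metis insert_DiffM)
    define r where "r = Polynomial.smult (Polynomial.lead_coeff ?q) (\<Prod>x\<in>#B. [:-x, 1:])"
    have q: "?q = [:-x, 1:] * ([:-x, 1:] * r)"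
      by (subst A(2)) (simp add: B r_def)
    have "poly ?q x = 0" "poly (pderiv ?q) x = 0"
      unfolding q pderiv_mult by simp_all
    with arg_cong[OF bez, of "\<lambda>s. poly s x"] show False by simp
  qed
  have "size A = card (set_mset A)"
    unfolding size_multiset_overloaded_eq using count by simp
  with A(1) roots show ?thesis by simp
qed

section \<open>Roots of Tschirnhaus transforms\<close>

lemma poly_monic_list:
  fixes P :: "'a::field poly"
  assumes "P \<in> monic_polys n"
  shows "poly P x = x ^ n + (\<Sum>j<n. map (Polynomial.coeff P) [0..<n] ! j * x ^ j)"
proof -
  have "poly P x = (\<Sum>j\<le>n. Polynomial.coeff P j * x ^ j)"
    using assms unfolding monic_polys_def by (simp add: poly_altdef)
  also have "\<dots> = x ^ n + (\<Sum>j<n. Polynomial.coeff P j * x ^ j)"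
    using assms unfolding monic_polys_def lessThan_Suc_atMost[symmetric] by (auto simp: add.commute)
  finally show ?thesis by simp
qed

text \<open>Over an algebraic closure of a field, its roots are the values of \<open>g\<close> at
  the roots of \<open>P\<close>.\<close>

definition tschirnhaus :: "nat \<Rightarrow> 'a::comm_ring_1 list \<Rightarrow> 'a list \<Rightarrow> 'a poly" where
  "tschirnhaus n ps gs = char_poly (poly_mat n gs (companion n ps))"

text \<open>The field is arbitrary because the lemma is applied twice: over the given field to the
  root of \<open>Q\<close>, and over the algebraic closure to bound the fibres.\<close>

lemma tschirnhaus_root:
  fixes P :: "'a::field poly"
  assumes "P \<in> monic_polys n" "n > 0" "poly P x = 0"
  shows "poly (tschirnhaus n (map (Polynomial.coeff P) [0..<n]) gs) (\<Sum>l<n. gs ! l * x ^ l) = 0"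
proof -
  have "eigenvector (companion n (map (Polynomial.coeff P) [0..<n])) (Matrix.vec n (\<lambda>i. x ^ i)) x"
    using assms by (intro companion_eigenvector) (simp_all only: poly_monic_list)
  from poly_mat_eigenvector[OF companion_carrier this]
  show ?thesis
    unfolding tschirnhaus_def eigenvalue_root_char_poly[OF poly_mat_carrier, symmetric]
    by (auto simp: eigenvalue_def)
qed

text \<open>Here generation by \<open>g\<close> enters: an eigenvector of \<open>g\<close> for
  \<open>c\<close> is also one of the companion matrix, and its eigenvalue there is a root of
  \<open>P\<close> in the same field.\<close>

lemma root_of_tschirnhaus_root:
  fixes P :: "'a::field poly"
  assumes P: "P \<in> monic_polys n"
    and kry: "Determinant.det (krylov n (poly_mat n gs (companion n (map (Polynomial.coeff P) [0..<n])))) \<noteq> 0"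
    and root: "poly (tschirnhaus n (map (Polynomial.coeff P) [0..<n]) gs) c = 0"
  shows "\<exists>x. poly P x = 0"
proof -
  let ?C = "companion n (map (Polynomial.coeff P) [0..<n])"
  from root obtain u where "eigenvector (poly_mat n gs ?C) u c"
    unfolding tschirnhaus_def eigenvalue_root_char_poly[OF poly_mat_carrier, symmetric] eigenvalue_def
    by blast
  from eigenvector_of_commuting[OF poly_mat_carrier companion_carrier
      poly_mat_commute[OF companion_carrier] kry this]
  obtain x where "eigenvector ?C u x" by blast
  from companion_eigenvector_root[OF this] show ?thesis
    using poly_monic_list[OF P] by metis
qed

section \<open>Base change to the algebraic closure and finiteness of the fibres\<close>

lemma map_companion: "length ps = n \<Longrightarrow> map_mat to_ac (companion n ps) = companion n (map to_ac ps)"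
  by (rule eq_matI) (auto simp: companion_def)

lemma map_poly_mat:
  assumes "length gs = n" "A \<in> carrier_mat n n"
  shows "map_mat to_ac (poly_mat n gs A) = poly_mat n (map to_ac gs) (map_mat to_ac A)"
proof (rule eq_matI)
  fix i j
  assume "i < dim_row (poly_mat n (map to_ac gs) (map_mat to_ac A))"
    "j < dim_col (poly_mat n (map to_ac gs) (map_mat to_ac A))"
  then have ij: "i < n" "j < n" by (auto simp: poly_mat_def)
  have "(map_mat to_ac A ^\<^sub>m l) $$ (i, j) = to_ac ((A ^\<^sub>m l) $$ (i, j))" for l
    unfolding to_ac.mat_hom_pow[OF assms(2), symmetric] using ij assms(2) by simp
  with ij assms(1) show "map_mat to_ac (poly_mat n gs A) $$ (i, j) =
      poly_mat n (map to_ac gs) (map_mat to_ac A) $$ (i, j)"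
    by (simp add: poly_mat_def to_ac_sum)
qed (simp_all add: poly_mat_def)

lemma map_tschirnhaus:
  assumes "length ps = n" "length gs = n"
  shows "map_poly to_ac (tschirnhaus n ps gs) = tschirnhaus n (map to_ac ps) (map to_ac gs)"
  unfolding tschirnhaus_def using assms
  by (simp add: to_ac.char_poly_hom[OF poly_mat_carrier, symmetric] map_poly_mat map_companion)

text \<open>The values of \<open>g\<close> at the \<open>n\<close> roots of \<open>P\<close> determine \<open>g\<close>, and they are roots of its
  Tschirnhaus transform.\<close>

lemma finite_tschirnhaus_fibre:
  fixes P :: "'k::field poly"
  assumes P: "P \<in> monic_polys n" "separable_poly P" and n: "n > 0"
  shows "finite {gs. length gs = n \<and> tschirnhaus n (map (Polynomial.coeff P) [0..<n]) gs = F}"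
    (is "finite ?S")
proof (cases "?S = {}")
  case False
  let ?ps = "map (Polynomial.coeff P) [0..<n]"
  from False obtain gs where "tschirnhaus n ?ps gs = F" by blast
  \<comment> \<open>\<open>F\<close> is arbitrary, but a nonempty fibre makes it a characteristic
    polynomial, so it is nonzero and has finitely many roots.\<close>
  then have "Polynomial.coeff F n = 1"
    using degree_monic_char_poly[OF poly_mat_carrier] unfolding tschirnhaus_def by blast
  then have F0: "F \<noteq> 0" by auto
  define R where "R = {x. poly (map_poly to_ac P) x = 0}"
  define R' where "R' = {x. poly (map_poly to_ac F) x = 0}"
  have P0: "P \<noteq> 0" using P(1) unfolding monic_polys_def by auto
  have "finite R" unfolding R_def using P0 by (intro poly_roots_finite) simp
  have "finite R'" unfolding R'_def using F0 by (intro poly_roots_finite) simp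
  have cardR: "card R = n"
    using card_roots_separable[OF P(2) P0] P(1) unfolding R_def monic_polys_def by simp
  define g where "g gs x = (\<Sum>l<n. map to_ac gs ! l * x ^ l)" for gs and x :: "'k alg_closure"
  have monic: "map_poly to_ac P \<in> monic_polys n"
    using P(1) unfolding monic_polys_def by auto
  have val: "g gs x \<in> R'" if "gs \<in> ?S" "x \<in> R" for gs x
  proof -
    have "poly (tschirnhaus n (map (Polynomial.coeff (map_poly to_ac P)) [0..<n]) (map to_ac gs)) (g gs x) = 0"
      unfolding g_def using that(2) n by (intro tschirnhaus_root monic) (simp_all add: R_def)
    also have "map (Polynomial.coeff (map_poly to_ac P)) [0..<n] = map to_ac ?ps" by simp
    also have "tschirnhaus n (map to_ac ?ps) (map to_ac gs) = map_poly to_ac F"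
      using that(1) map_tschirnhaus[of ?ps n gs] by simp
    finally show ?thesis unfolding R'_def by simp
  qed
  have "inj_on (\<lambda>gs. restrict (g gs) R) ?S"
  proof (rule inj_onI)
    fix gs hs assume gs: "gs \<in> ?S" and hs: "hs \<in> ?S" and eq: "restrict (g gs) R = restrict (g hs) R"
    \<comment> \<open>The difference of the two polynomials over the closure: of degree below
      \<open>n\<close>, yet zero at the \<open>n\<close> elements of \<open>R\<close>.\<close>
    define p where "p = (\<Sum>l<n. Polynomial.monom (to_ac (gs ! l - hs ! l)) l)"
    have coeff_p: "Polynomial.coeff p l = to_ac (gs ! l - hs ! l)" if "l < n" for l
      using that unfolding p_def by (simp add: coeff_sum)
    have "poly p x = g gs x - g hs x" for x
      using gs hs unfolding p_def g_def
      by (simp add: poly_sum poly_monom sum_subtractf algebra_simps)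
    moreover have "g gs x = g hs x" if "x \<in> R" for x using fun_cong[OF eq, of x] that by simp
    ultimately have R: "R \<subseteq> {x. poly p x = 0}" by auto
    have deg: "Polynomial.degree p < n"
      unfolding p_def using n by (intro degree_sum_less) (auto intro: le_less_trans[OF degree_monom_le])
    have "p = 0"
    proof (rule ccontr)
      assume "p \<noteq> 0"
      then have "card R \<le> Polynomial.degree p"
        using card_poly_roots_bound[of p] card_mono[OF poly_roots_finite R] by fastforce
      with cardR deg show False by simp
    qed
    with coeff_p have "gs ! l = hs ! l" if "l < n" for l
      using that by (metis coeff_0 eq_iff_diff_eq_0 to_ac_eq_0_iff)
    with gs hs show "gs = hs" by (auto intro: nth_equalityI)
  qed
  moreover have "(\<lambda>gs. restrict (g gs) R) ` ?S \<subseteq> R \<rightarrow>\<^sub>E R'"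
    using val by auto
  ultimately show ?thesis
    using finite_PiE[OF \<open>finite R\<close>, of "\<lambda>_. R'"] \<open>finite R'\<close> by (meson finite_imageD finite_subset)
next
  case True
  then show ?thesis by (simp only: finite.emptyI)
qed

text \<open>Both \<open>ps\<close> and \<open>gs\<close> may depend on \<open>xs\<close>, so one
  statement covers varying \<open>g\<close> at fixed \<open>P\<close> and varying \<open>P\<close>
  at fixed \<open>g\<close>.\<close>

lemma polyfun_poly_mat_nth:
  assumes "\<And>i. i < n \<Longrightarrow> polyfun m (\<lambda>xs. ps xs ! i)" "\<And>i. i < n \<Longrightarrow> polyfun m (\<lambda>xs. gs xs ! i)"
    and "i < n" "j < n"
  shows "polyfun m (\<lambda>xs. poly_mat n (gs xs) (companion n (ps xs)) $$ (i, j))"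
proof -
  have C: "polyfun m (\<lambda>xs. companion n (ps xs) $$ (i, j))" if "i < n" "j < n" for i j
    using that assms(1)
    by (cases "Suc i = n"; cases "j = Suc i")
       (auto simp: companion_def intro: polyfun_uminus polyfun_const)
  show ?thesis
    using assms polyfun_pow_mat[OF companion_carrier C]
    by (auto simp: poly_mat_def intro!: polyfun_sum polyfun_mult)
qed

lemma polyfun_coeff_tschirnhaus:
  assumes "\<And>i. i < n \<Longrightarrow> polyfun m (\<lambda>xs. ps xs ! i)" "\<And>i. i < n \<Longrightarrow> polyfun m (\<lambda>xs. gs xs ! i)"
  shows "polyfun m (\<lambda>xs. Polynomial.coeff (tschirnhaus n (ps xs) (gs xs)) l)"
  unfolding tschirnhaus_def
  by (intro polyfun_coeff_char_poly[OF poly_mat_carrier] polyfun_poly_mat_nth assms)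

lemma polyfun_det_krylov:
  assumes "\<And>i. i < n \<Longrightarrow> polyfun m (\<lambda>xs. ps xs ! i)" "\<And>i. i < n \<Longrightarrow> polyfun m (\<lambda>xs. gs xs ! i)"
  shows "polyfun m (\<lambda>xs. Determinant.det (krylov n (poly_mat n (gs xs) (companion n (ps xs)))))"
proof (rule polyfun_det[OF krylov_carrier])
  fix i j assume "i < n" "j < n"
  moreover from this
  have "polyfun m (\<lambda>xs. (poly_mat n (gs xs) (companion n (ps xs)) ^\<^sub>m i) $$ (0, j))"
    by (intro polyfun_pow_mat[OF poly_mat_carrier] polyfun_poly_mat_nth assms) auto
  ultimately show "polyfun m (\<lambda>xs. krylov n (poly_mat n (gs xs) (companion n (ps xs))) $$ (i, j))"
    by (simp add: krylov_def)
qed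


section \<open>Bronze t-henselianity\<close>

text \<open>Both polynomials are monic of degree \<open>n\<close>, so recording only the lower
  coefficients loses nothing.\<close>

lemma tschirnhaus_eqI:
  fixes ps gs ps' gs' :: "'a::comm_ring_1 list"
  assumes "map (Polynomial.coeff (tschirnhaus n ps gs)) [0..<n] =
    map (Polynomial.coeff (tschirnhaus n ps' gs')) [0..<n]"
  shows "tschirnhaus n ps gs = tschirnhaus n ps' gs'"
proof (rule poly_eqI)
  have deg: "Polynomial.degree (tschirnhaus n ps gs) = n \<and> Polynomial.coeff (tschirnhaus n ps gs) n = 1"
    for ps gs :: "'a list"
    unfolding tschirnhaus_def by (rule degree_monic_char_poly) simp
  fix l
  consider "l < n" | "l = n" | "l > n" by linarith
  then show "Polynomial.coeff (tschirnhaus n ps gs) l = Polynomial.coeff (tschirnhaus n ps' gs') l"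
  proof cases
    case 1
    with arg_cong[OF assms, of "\<lambda>xs. xs ! l"] show ?thesis by simp
  qed (use deg in \<open>auto simp: coeff_eq_0\<close>)
qed

theorem theorem3p7:
  fixes M :: "('f, 'r, 'm) fo_struct" and \<kappa> :: "'c rel"
    and k :: nat and \<iota> :: "'k::field \<Rightarrow> 'm list"
    and \<tau> :: "'k topology" and \<delta> :: "'k list set \<Rightarrow> ereal"
  assumes "monster_model \<kappa> M"
    and "definable_field M k \<iota>"
    and dim_values: "\<And>n X. K_definable M k \<iota> n X \<Longrightarrow> \<delta> X = -\<infinity> \<or> (\<exists>r::nat. \<delta> X = ereal (real r))"
    and dim1: "\<And>n X. K_definable M k \<iota> n X \<Longrightarrow> \<delta> X = -\<infinity> \<longleftrightarrow> X = {}"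
    and dim2: "\<delta> (K_power 1) > 0"
    and dim3: "\<And>n X. K_definable M k \<iota> n X \<Longrightarrow> \<delta> X > 0 \<Longrightarrow> infinite X"
    and dim4: "\<And>m n X Y. K_definable M k \<iota> m X \<Longrightarrow> K_definable M k \<iota> n Y \<Longrightarrow>
                 \<delta> (list_times X Y) = \<delta> X + \<delta> Y"
    and dim5: "\<And>n X Y. K_definable M k \<iota> n X \<Longrightarrow> K_definable M k \<iota> n Y \<Longrightarrow>
                 \<delta> (X \<union> Y) = max (\<delta> X) (\<delta> Y)"
    and dim6: "\<And>m n X Y f. definable_surj_finite_fibers M k \<iota> m n X Y f \<Longrightarrow> \<delta> X = \<delta> Y"
    and "field_topology \<tau>"
    and "definable_topology M k \<iota> \<tau>"
    and dim7: "\<And>n X. K_definable M k \<iota> n X \<Longrightarrow>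
                 \<delta> X = \<delta> (K_power n) \<longleftrightarrow> power_topology \<tau> n interior_of X \<noteq> {}"
  shows "bronze_t_henselian \<tau>"
proof -
  let ?cs = "\<lambda>d P. map (Polynomial.coeff P) [0..<d] :: 'k list"
  let ?X = "{xs \<in> K_power 1. xs ! 0 \<noteq> 0} :: 'k list set"
  note field = assms(2) and top = assms(10)
  have nz: "K_definable M k \<iota> n {xs \<in> K_power n. f xs \<noteq> 0}" if "polyfun n f" for n f
    using K_pred_nonzero[OF field that] by (intro K_definableI[OF field]) auto
  \<comment> \<open>First, the complement of 0 is open. The finite set \<open>{[0]}\<close> cannot
    have positive dimension, so by \<open>dim5\<close> its complement has the dimension of the line,
    and by \<open>dim7\<close> it has an interior point.\<close>
  have X: "K_definable M k \<iota> 1 ?X" by (intro nz polyfun_nth) simp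
  have "K_pred M k \<iota> (\<lambda>v. v 0 = 0)"
    by (intro K_pred_fun_eq[OF field] K_fun_var[OF field] K_fun_const[OF field])
  then have zero: "K_definable M k \<iota> 1 {[0]}"
    by (intro K_definableI[OF field]) (auto simp: K_power_def)
  have "{xs \<in> K_power 1. xs ! 0 \<noteq> 0} \<union> {[0]} = (K_power 1 :: 'k list set)"
    by (auto simp: K_power_def length_Suc_conv)
  then have "max (\<delta> ?X) (\<delta> {[0]}) = \<delta> (K_power 1)"
    using dim5[OF X zero] by simp
  moreover have "\<not> \<delta> {[0]} > 0" using dim3[OF zero] by auto
  ultimately have "\<delta> ?X = \<delta> (K_power 1)" using dim2 by (auto simp: max_def split: if_splits)
  then obtain s S where S: "openin (power_topology \<tau> 1) S" "S \<subseteq> ?X" "s \<in> S"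
    using dim7[OF X] unfolding interior_of_def by blast
  have "continuous_map \<tau> (power_topology \<tau> 1) (\<lambda>x. [x])"
    by (intro continuous_map_into_power[OF top]) auto
  from openin_continuous_map_preimage[OF this S(1)] have "openin \<tau> {x. [x] \<in> S}"
    by (simp add: topspace_field_topology[OF top])
  moreover have "[hd s] \<in> S" using S(2,3) by (auto simp: K_power_def length_Suc_conv)
  moreover have "[0] \<notin> S" using S(2) by auto
  ultimately have open_nz: "openin \<tau> (- {0})"
    by (intro openin_nonzero_if_nontrivial[OF top, of "{x. [x] \<in> S}" "hd s"]) auto
  show ?thesis
    unfolding bronze_t_henselian_def
  proof (intro allI ballI impI)
    fix d and Q :: "'k poly"
    assume Q: "Q \<in> monic_polys d" and "separable_poly Q \<and> (\<exists>x. poly Q x = 0)"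
    then obtain a where sep: "separable_poly Q" and a: "poly Q a = 0" by blast
    have d: "d > 0"
    proof (rule ccontr)
      assume "\<not> d > 0"
      then obtain c where "Q = [:c:]" using Q unfolding monic_polys_def by (auto elim: degree_eq_zeroE)
      with Q a show False unfolding monic_polys_def by simp
    qed
    define \<Delta> :: "'k list \<Rightarrow> 'k list \<Rightarrow> 'k" where
      "\<Delta> ps gs = Determinant.det (krylov d (poly_mat d gs (companion d ps)))" for ps gs
    define T where "T ps gs = map (\<lambda>i. Polynomial.coeff (tschirnhaus d ps gs) i) [0..<d]"
      for ps gs :: "'k list"
    define W where "W = {gs \<in> K_power d. \<Delta> (?cs d Q) gs \<noteq> 0}"
    \<comment> \<open>Dependence on \<open>gs\<close> at \<open>P = Q\<close> gives the definability
      and openness of \<open>W\<close>; dependence on \<open>ps\<close> at fixed \<open>gs\<close>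
      gives continuity in \<open>P\<close> near \<open>Q\<close>.\<close>
    have poly_\<Delta>: "polyfun d (\<Delta> (?cs d Q))" "polyfun d (\<lambda>ps. \<Delta> ps gs)" for gs
      unfolding \<Delta>_def by (intro polyfun_det_krylov polyfun_const polyfun_nth; assumption)+
    have poly_T: "polyfun d (\<lambda>gs. Polynomial.coeff (tschirnhaus d (?cs d Q) gs) i)"
      "polyfun d (\<lambda>ps. Polynomial.coeff (tschirnhaus d ps gs) i)" for gs i
      by (intro polyfun_coeff_tschirnhaus polyfun_const polyfun_nth; assumption)+
    have W: "K_definable M k \<iota> d W" unfolding W_def by (intro nz poly_\<Delta>)
    have W_pred: "W \<subseteq> K_power d" "K_pred M k \<iota> (\<lambda>v. map v [0..<d] \<in> W)"
      unfolding W_def using K_pred_nonzero[OF field poly_\<Delta>(1)] by auto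
    \<comment> \<open>Being open and containing the coefficient list of \<open>X\<close>,
      \<open>W\<close> has full dimension by \<open>dim7\<close>; \<open>dim6\<close> then passes
      this dimension on to the image.\<close>
    have "openin (power_topology \<tau> d) W"
      using openin_polyfun_nonzero[OF top open_nz poly_\<Delta>(1) continuous_map_nth[OF top]]
      unfolding W_def topspace_power_topology[OF top] .
    then have "power_topology \<tau> d interior_of W = W" by (simp add: interior_of_openin)
    moreover have "map (\<lambda>l. if l = 1 then 1 else 0) [0..<d] \<in> W"
      unfolding W_def \<Delta>_def using det_krylov_generator[OF d] by (simp add: K_power_def)
    ultimately have "\<delta> W = \<delta> (K_power d)" using dim7[OF W] by blast
    moreover have image: "K_definable M k \<iota> d (T (?cs d Q) ` W)"
      unfolding T_def by (intro K_definable_polymap_image[OF field W_pred] poly_T)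
    moreover have "definable_surj_finite_fibers M k \<iota> d d W (T (?cs d Q) ` W) (T (?cs d Q))"
      unfolding definable_surj_finite_fibers_def
    proof (intro conjI ballI W image)
      show "K_definable M k \<iota> (d + d) {xs @ T (?cs d Q) xs |xs. xs \<in> W}"
        unfolding T_def by (intro K_definable_polymap_graph[OF field W_pred] poly_T)
      fix y assume "y \<in> T (?cs d Q) ` W"
      then obtain h where h: "y = T (?cs d Q) h" by blast
      have "{x \<in> W. T (?cs d Q) x = y} \<subseteq>
          {gs. length gs = d \<and> tschirnhaus d (?cs d Q) gs = tschirnhaus d (?cs d Q) h}"
        unfolding h T_def using W_pred(1) by (auto simp: K_power_def intro: tschirnhaus_eqI)
      then show "finite {x \<in> W. T (?cs d Q) x = y}"
        using finite_tschirnhaus_fibre[OF Q sep d] finite_subset by blast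
    qed simp
    ultimately have "\<delta> (T (?cs d Q) ` W) = \<delta> (K_power d)" using dim6 by metis
    then obtain U y where U: "openin (power_topology \<tau> d) U" "U \<subseteq> T (?cs d Q) ` W" "y \<in> U"
      using dim7[OF image] unfolding interior_of_def by blast
    \<comment> \<open>From here on \<open>g\<close> is a generator whose transform is an interior
      point of the image; it stays fixed while \<open>P\<close> varies.\<close>
    then obtain g where g: "g \<in> W" "T (?cs d Q) g \<in> U" by blast
    \<comment> \<open>For \<open>P\<close> in \<open>V\<close>, \<open>g\<close> still generates the
      algebra of \<open>P\<close>, and its transform stays inside the image of
      \<open>W\<close>.\<close>
    define V where "V = {P \<in> monic_polys d. \<Delta> (?cs d P) g \<noteq> 0} \<inter> {P \<in> monic_polys d. T (?cs d P) g \<in> U}"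
    have cont: "continuous_map (monic_topology \<tau> d) \<tau> (\<lambda>P. ?cs d P ! i)" if "i < d" for i
      using continuous_map_coeff[OF top that] that by simp
    have "continuous_map (monic_topology \<tau> d) (power_topology \<tau> d) (\<lambda>P. T (?cs d P) g)"
      unfolding T_def using continuous_map_polyfun[OF top poly_T(2) cont]
      by (intro continuous_map_into_power[OF top]) simp_all
    from openin_continuous_map_preimage[OF this U(1)]
      openin_polyfun_nonzero[OF top open_nz poly_\<Delta>(2) cont]
    have "openin (monic_topology \<tau> d) V"
      unfolding V_def topspace_monic_topology[OF top] by blast
    moreover have "Q \<in> V" using Q g unfolding V_def W_def by simp
    moreover have "\<exists>x. poly P x = 0" if "P \<in> V" for P
    proof -
      \<comment> \<open>The transform of \<open>P\<close> by \<open>g\<close> equals that of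
        \<open>Q\<close> by some \<open>h\<close>, which depends on \<open>P\<close>; hence it has
        the root \<open>h(a)\<close> in the field.\<close>
      from that U(2) obtain h where P: "P \<in> monic_polys d" "\<Delta> (?cs d P) g \<noteq> 0"
        and h: "T (?cs d P) g = T (?cs d Q) h" unfolding V_def by blast
      have "tschirnhaus d (?cs d P) g = tschirnhaus d (?cs d Q) h"
        using h unfolding T_def by (intro tschirnhaus_eqI) simp
      then have "poly (tschirnhaus d (?cs d P) g) (\<Sum>l<d. h ! l * a ^ l) = 0"
        using tschirnhaus_root[OF Q d a] by simp
      with P show ?thesis unfolding \<Delta>_def by (intro root_of_tschirnhaus_root)
    qed
    ultimately show "\<exists>V. openin (monic_topology \<tau> d) V \<and> Q \<in> V \<and> (\<forall>P\<in>V. \<exists>x. poly P x = 0)"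
      by blast
  qed
qed

end
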